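(* Let $d\ge5$. Suppose that $V\colon\mathbb{R}^d\to\mathbb{C}$ satisfies $V\in L^1_{\mathrm{loc}}(\mathbb{R}^d)$ and $r^2V\in L^2_{\mathrm{loc}}(\mathbb{R}^d)$. Moreover, given $\delta>0$, assume that $$\forall\,\psi\in H^2(\mathbb{R}^d),\qquad\int_{\mathbb{R}^d}r^4|V|^2|\psi|^2\le a_\delta^2\int_{\mathbb{R}^d}|\Delta\psi|^2,$$ where $a_\delta>0$ is such that $\left(1+\frac1\delta\right)\frac{a_\delta}{\sqrt{C_{\mathrm R}}}<1$, with $C_{\mathrm R}=d^2(d-4)^2/16$. Then $$\sigma_{\mathrm p}(\Delta^2+V)\subseteq\{z\in\mathbb{C}\colon|\operatorname{Im}z|\le\delta\operatorname{Re}z\}.$$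
   Context: Notation: $r(x):=|x|$. $C_{\mathrm R}=d^2(d-4)^2/16$ is the sharp constant of the Rellich inequality $\int_{\mathbb{R}^d}|\Delta\psi|^2\ge C_{\mathrm R}\int_{\mathbb{R}^d}|\psi|^2/r^4$ for $\psi\in H^2(\mathbb{R}^d)$, $d\ge5$. The eigenvalue equation is understood weakly: $z\in\mathbb{C}$ belongs to the point spectrum $\sigma_{\mathrm p}(\Delta^2+V)$ iff there is a nonzero $u\in H^2(\mathbb{R}^d)$ such that $\int_{\mathbb{R}^d}\Delta u\,\overline{\Delta v}+\int_{\mathbb{R}^d}Vu\,\bar v=z\int_{\mathbb{R}^d}u\,\bar v$ for all $v\in H^2(\mathbb{R}^d)$. (The middle integral converges since $r^2Vu\in L^2$ by hypothesis and $r^{-2}v\in L^2$ by the Rellich inequality.) *)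

theory Defs
  imports "HOL-Analysis.Analysis"
begin

text \<open>
  Integrals are taken with respect to the completed Lebesgue measure \<open>lebesgue\<close>, so functions
  are only required to be Lebesgue (not Borel) measurable. Elements of \<open>L\<^sup>2\<close> and \<open>H\<^sup>2\<close>
  are represented by functions; identification up to null sets is made explicit where it matters.
\<close>

definition locally_integrable :: "('a::euclidean_space \<Rightarrow> complex) \<Rightarrow> bool" where
  "locally_integrable f \<longleftrightarrow> (\<forall>K. compact K \<longrightarrow> f absolutely_integrable_on K)"

definition L2 :: "('a::euclidean_space \<Rightarrow> complex) set" where
  "L2 = {f. f \<in> borel_measurable lebesgue \<and> integrable lebesgue (\<lambda>x. (cmod (f x))\<^sup>2)}"

definition L2_loc :: "('a::euclidean_space \<Rightarrow> complex) set" where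
  "L2_loc = {f. f \<in> borel_measurable lebesgue \<and>
     (\<forall>K. compact K \<longrightarrow> (\<lambda>x. (cmod (f x))\<^sup>2) absolutely_integrable_on K)}"

text \<open>
  A list of basis vectors plays the role of a multi-index: \<open>iter_partial [b\<^sub>1, \<dots>, b\<^sub>k] f\<close> is
  the iterated directional derivative of \<open>f\<close> along \<open>b\<^sub>k\<close>, then \<open>\<dots>\<close>, then \<open>b\<^sub>1\<close>.
\<close>

primrec iter_partial ::
    "'a::euclidean_space list \<Rightarrow> ('a \<Rightarrow> complex) \<Rightarrow> 'a \<Rightarrow> complex" where
  "iter_partial [] f = f"
| "iter_partial (b # bs) f = (\<lambda>x. frechet_derivative (iter_partial bs f) (at x) b)"

text \<open>
  Differentiability of all iterated partial derivatives (hence their continuity) is the same as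
  being \<open>C\<^sup>\<infinity>\<close>.
\<close>

definition smooth :: "('a::euclidean_space \<Rightarrow> complex) \<Rightarrow> bool" where
  "smooth f \<longleftrightarrow> (\<forall>bs. set bs \<subseteq> Basis \<longrightarrow> iter_partial bs f differentiable_on UNIV)"

definition test_functions :: "('a::euclidean_space \<Rightarrow> complex) set" where
  "test_functions = {\<phi>. smooth \<phi> \<and> compact (closure {x. \<phi> x \<noteq> 0})}"

definition has_weak_derivative ::
    "'a::euclidean_space list \<Rightarrow> ('a \<Rightarrow> complex) \<Rightarrow> ('a \<Rightarrow> complex) \<Rightarrow> bool" where
  "has_weak_derivative bs f g \<longleftrightarrow>
     locally_integrable f \<and> locally_integrable g \<and>
     (\<forall>\<phi>\<in>test_functions.
        (LINT x|lebesgue. f x * iter_partial bs \<phi> x) =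
        (-1) ^ length bs * (LINT x|lebesgue. g x * \<phi> x))"

text \<open>Where a weak derivative exists it is unique up to a null set; an arbitrary one is chosen.\<close>

definition weak_derivative ::
    "'a::euclidean_space list \<Rightarrow> ('a \<Rightarrow> complex) \<Rightarrow> 'a \<Rightarrow> complex" where
  "weak_derivative bs f = (SOME g. has_weak_derivative bs f g)"

definition sobolev_H :: "nat \<Rightarrow> ('a::euclidean_space \<Rightarrow> complex) set" where
  "sobolev_H k = {u \<in> L2. \<forall>bs. set bs \<subseteq> Basis \<and> length bs \<le> k \<longrightarrow>
     (\<exists>g\<in>L2. has_weak_derivative bs u g)}"

definition weak_laplacian :: "('a::euclidean_space \<Rightarrow> complex) \<Rightarrow> 'a \<Rightarrow> complex" where
  "weak_laplacian u = (\<lambda>x. \<Sum>b\<in>Basis. weak_derivative [b, b] u x)"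

definition rellich_constant :: "nat \<Rightarrow> real" where
  "rellich_constant d = (real d)\<^sup>2 * (real d - 4)\<^sup>2 / 16"

text \<open>
  Point spectrum of \<open>\<Delta>\<^sup>2 + V\<close>, in the weak sense. The integral of \<open>V u v\<close> is
  a Bochner integral; it converges for all \<open>u\<close>, \<open>v\<close> in \<open>H\<^sup>2\<close> whenever \<open>r\<^sup>2 V u\<close> and
  \<open>v / r\<^sup>2\<close> are square integrable, and only potentials of this kind are considered.
\<close>

definition point_spectrum_bilaplacian ::
    "('a::euclidean_space \<Rightarrow> complex) \<Rightarrow> complex set" where
  "point_spectrum_bilaplacian V =
     {z. \<exists>u\<in>sobolev_H 2. \<not> (AE x in lebesgue. u x = 0) \<and>
        (\<forall>v\<in>sobolev_H 2.
           (LINT x|lebesgue. weak_laplacian u x * cnj (weak_laplacian v x)) +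
           (LINT x|lebesgue. V x * u x * cnj (v x)) =
           z * (LINT x|lebesgue. u x * cnj (v x)))}"

end

theory Submission
  imports Defs
begin

text \<open>
  Testing the eigenvalue equation with \<open>v = u\<close> gives
  \<open>z \<parallel>u\<parallel>\<^sup>2 = \<parallel>\<Delta>u\<parallel>\<^sup>2 + \<integral>V |u|\<^sup>2\<close>. By the hypothesis on \<open>V\<close>, the Rellich inequality and
  Cauchy-Schwarz the last term is at most \<open>\<kappa> \<parallel>\<Delta>u\<parallel>\<^sup>2\<close> with \<open>\<kappa> = a / sqrt C\<^sub>R\<close>, so
  \<open>Re z \<parallel>u\<parallel>\<^sup>2 \<ge> (1 - \<kappa>) \<parallel>\<Delta>u\<parallel>\<^sup>2\<close> and \<open>|Im z| \<parallel>u\<parallel>\<^sup>2 \<le> \<kappa> \<parallel>\<Delta>u\<parallel>\<^sup>2\<close>; the condition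
  on \<open>\<kappa>\<close> says precisely that \<open>\<kappa> < \<delta> (1 - \<kappa>)\<close>.

  The Rellich inequality for \<open>H\<^sup>2\<close> functions is reduced to mollifications. With
  \<open>m = 1 / (r\<^sup>2 + \<epsilon>)\<close> all integrands in the divergence argument are integrable, so neither a
  cutoff nor density of \<open>C\<^sub>c\<^sup>\<infinity>\<close> away from the origin is needed. Passing to the limit uses only
  weak convergence of the mollifications and lower semicontinuity of the weighted norm.
\<close>

section \<open>Bump functions and test functions\<close>

text \<open>The Laplacian of an \<open>H^2\<close> function is visible only through pairings with
  test functions, and \<open>weak_derivative\<close> selects an arbitrary representative. The
  fundamental lemma of the calculus of variations shows that the selected function is again in
  \<open>L2\<close>; mollification then turns weak derivatives into continuous classical ones, to
  which a pointwise computation applies.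

  The sharp constant is \<open>k^2\<close> with \<open>k = d (d - 4) / 4\<close>. It arises in two
  steps: a completed square in the gradient, integrated with a divergence, gives that the integral
  of \<open>m Re (cnj u \<Delta>u) + k m^2 |u|^2\<close> is at most 0; a second completed square
  trades the mixed term for \<open>|\<Delta>u|^2\<close>. Replacing \<open>1 / r^2\<close> by
  \<open>m\<close> costs only the estimate \<open>r^2 m \<le> 1\<close>, which enters with the
  favourable sign, so each \<open>\<epsilon>\<close> already gives the sharp constant. The bounds on
  \<open>m\<close> and \<open>x m\<close> that blow up as \<open>\<epsilon>\<close> tends to 0 serve
  integrability only and never reach the final inequality.\<close>

definition flat :: "nat \<Rightarrow> real \<Rightarrow> real" where
  "flat n t = (if t > 0 then exp (- 1 / t) / t ^ n else 0)"

lemma flat_nonneg: "flat n t \<ge> 0"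
  by (simp add: flat_def)

lemma flat_pos: "t > 0 \<Longrightarrow> flat n t > 0"
  by (simp add: flat_def)

lemma tendsto_flat_0: "(flat n \<longlongrightarrow> 0) (at 0)"
proof (rule filterlim_split_at)
  show "(flat n \<longlongrightarrow> 0) (at_left 0)"
    by (rule tendsto_eventually)
      (auto simp: eventually_at_filter flat_def)
  have "((\<lambda>t. inverse t ^ n / exp (inverse t)) \<longlongrightarrow> 0) (at_right (0::real))"
    by (rule filterlim_compose[OF tendsto_power_div_exp_0 filterlim_inverse_at_top_right])
  then show "(flat n \<longlongrightarrow> 0) (at_right 0)"
    by (rule Lim_transform_eventually)
      (auto simp: eventually_at_filter flat_def exp_minus divide_simps)
qed

text \<open>The negative powers of \<open>t\<close> are carried along because differentiating
  \<open>exp (- 1 / t)\<close> produces them; the family is thereby closed under differentiation up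
  to linear combinations. At 0 the difference quotient of \<open>flat n\<close> is exactly
  \<open>flat (n + 1)\<close>, so the limit at 0 of the next member gives the derivative.\<close>

lemma flat_has_real_derivative:
  "(flat n has_real_derivative flat (n + 2) t - of_nat n * flat (n + 1) t) (at t)"
proof -
  consider "t > 0" | "t < 0" | "t = 0" by linarith
  then show ?thesis
  proof cases
    case 1
    have n: "of_nat n * t ^ (n - 1) = of_nat n * t ^ n / t"
      using 1 by (cases n) auto
    have "((\<lambda>t. exp (- 1 / t) / t ^ n) has_real_derivative
        (exp (- 1 / t) * (1 / t\<^sup>2) * t ^ n - exp (- 1 / t) * (of_nat n * t ^ (n - 1))) / (t ^ n * t ^ n)) (at t)"
      using 1 by (auto intro!: derivative_eq_intros simp: power2_eq_square)
    moreover have "(exp (- 1 / t) * (1 / t\<^sup>2) * t ^ n - exp (- 1 / t) * (of_nat n * t ^ (n - 1))) / (t ^ n * t ^ n)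
        = flat (n + 2) t - of_nat n * flat (n + 1) t"
      using 1 unfolding n by (simp add: flat_def divide_simps power2_eq_square) (simp add: algebra_simps)
    ultimately have "((\<lambda>t. exp (- 1 / t) / t ^ n) has_real_derivative
        flat (n + 2) t - of_nat n * flat (n + 1) t) (at t)"
      by simp
    then show ?thesis
      by (rule has_field_derivative_transform_within_open[where S="{0<..}"])
        (use 1 in \<open>auto simp: flat_def\<close>)
  next
    case 2
    have "((\<lambda>t. 0) has_real_derivative flat (n + 2) t - of_nat n * flat (n + 1) t) (at t)"
      using 2 by (auto simp: flat_def)
    then show ?thesis
      by (rule has_field_derivative_transform_within_open[where S="{..<0}"])
        (use 2 in \<open>auto simp: flat_def\<close>)
  next
    case 3
    have "((\<lambda>h. (flat n (0 + h) - flat n 0) / h) \<longlongrightarrow> 0) (at 0)"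
      by (rule Lim_transform_eventually[OF tendsto_flat_0[of "n + 1"]])
        (auto simp: eventually_at_filter flat_def field_simps)
    then show ?thesis
      using 3 by (simp add: DERIV_def flat_def)
  qed
qed

text \<open>The argument order \<open>p' h x\<close> separates the two roles: linear in the
  direction, and for a fixed direction again a polynomial in the point. The second property is what
  keeps \<open>bumps\<close> closed under partial derivatives.\<close>

lemma real_polynomial_function_has_derivative:
  fixes p :: "'a::euclidean_space \<Rightarrow> real"
  assumes "real_polynomial_function p"
  shows "\<exists>p'. (\<forall>x. (p has_derivative (\<lambda>h. p' h x)) (at x)) \<and>
    (\<forall>h. real_polynomial_function (p' h))"
  using assms
proof induction
  case (linear f)
  then show ?case
    by (intro exI[of _ "\<lambda>h x. f h"]) (auto intro: bounded_linear_imp_has_derivative)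
next
  case (const c)
  then show ?case
    by (intro exI[of _ "\<lambda>h x. 0"]) auto
next
  case (add f g)
  then obtain f' g' where "\<forall>x. (f has_derivative (\<lambda>h. f' h x)) (at x)" "\<forall>h. real_polynomial_function (f' h)"
    "\<forall>x. (g has_derivative (\<lambda>h. g' h x)) (at x)" "\<forall>h. real_polynomial_function (g' h)"
    by blast
  then show ?case
    by (intro exI[of _ "\<lambda>h x. f' h x + g' h x"]) (auto intro: has_derivative_add)
next
  case (mult f g)
  then obtain f' g' where "\<forall>x. (f has_derivative (\<lambda>h. f' h x)) (at x)" "\<forall>h. real_polynomial_function (f' h)"
    "\<forall>x. (g has_derivative (\<lambda>h. g' h x)) (at x)" "\<forall>h. real_polynomial_function (g' h)"
    by blast
  with mult.hyps show ?case
    by (intro exI[of _ "\<lambda>h x. f x * g' h x + f' h x * g x"]) (auto intro!: has_derivative_mult real_polynomial_function.intros(3,4))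
qed

text \<open>Closed under partial derivatives, which reduces smoothness to differentiability of each member.\<close>

inductive_set bumps :: "real \<Rightarrow> ('a::euclidean_space \<Rightarrow> complex) set" for R where
  poly: "real_polynomial_function p \<Longrightarrow>
    (\<lambda>x. complex_of_real (p x * flat n (R\<^sup>2 - x \<bullet> x))) \<in> bumps R"
| add: "f \<in> bumps R \<Longrightarrow> g \<in> bumps R \<Longrightarrow> (\<lambda>x. f x + g x) \<in> bumps R"

lemma real_polynomial_function_inner: "real_polynomial_function (\<lambda>x. x \<bullet> h)"
  by (intro real_polynomial_function.intros bounded_linear_inner_left)

text \<open>The inner function \<open>R^2 - x \<bullet> x\<close> has the polynomial directional
  derivative \<open>- 2 (x \<bullet> h)\<close>. The product and chain rules therefore give three
  terms, each a polynomial times some \<open>flat j\<close> of the same inner function.\<close>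

lemma bumps_has_derivative:
  fixes f :: "'a::euclidean_space \<Rightarrow> complex"
  assumes "f \<in> bumps R"
  shows "\<exists>f'. (\<forall>x. (f has_derivative (\<lambda>h. f' h x)) (at x)) \<and> (\<forall>h. f' h \<in> bumps R)"
  using assms
proof induction
  case (poly p n)
  obtain p' where p': "\<And>x. (p has_derivative (\<lambda>h. p' h x)) (at x)"
    and "\<And>h. real_polynomial_function (p' h)"
    using real_polynomial_function_has_derivative[OF poly] by blast
  define f' where "f' = (\<lambda>h x. (complex_of_real (p' h x * flat n (R\<^sup>2 - x \<bullet> x)) +
    complex_of_real ((p x * (- 2 * (x \<bullet> h))) * flat (n + 2) (R\<^sup>2 - x \<bullet> x))) +
    complex_of_real ((p x * (2 * real n * (x \<bullet> h))) * flat (n + 1) (R\<^sup>2 - x \<bullet> x)))"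
  have "f' h \<in> bumps R" for h
    unfolding f'_def
    by (intro bumps.intros real_polynomial_function.intros(2,4)
        real_polynomial_function_inner poly) fact
  moreover have "((\<lambda>x. complex_of_real (p x * flat n (R\<^sup>2 - x \<bullet> x))) has_derivative (\<lambda>h. f' h x)) (at x)" for x
  proof -
    have "((\<lambda>x. R\<^sup>2 - x \<bullet> x) has_derivative (\<lambda>h. - (2 * (x \<bullet> h)))) (at x)"
      by (auto intro!: derivative_eq_intros simp: inner_commute)
    then have "((\<lambda>x. flat n (R\<^sup>2 - x \<bullet> x)) has_derivative
      (\<lambda>h. - (2 * (x \<bullet> h)) * (flat (n + 2) (R\<^sup>2 - x \<bullet> x) - of_nat n * flat (n + 1) (R\<^sup>2 - x \<bullet> x)))) (at x)"
      by (rule DERIV_compose_FDERIV[OF flat_has_real_derivative])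
    from has_derivative_of_real[OF has_derivative_mult[OF p' this]]
    show ?thesis
      by (rule has_derivative_eq_rhs) (simp add: f'_def fun_eq_iff algebra_simps)
  qed
  ultimately show ?case by blast
next
  case (add f g)
  then obtain f' g' where "\<forall>x. (f has_derivative (\<lambda>h. f' h x)) (at x)" "\<forall>h. f' h \<in> bumps R"
    "\<forall>x. (g has_derivative (\<lambda>h. g' h x)) (at x)" "\<forall>h. g' h \<in> bumps R"
    by blast
  then show ?case
    by (intro exI[of _ "\<lambda>h x. f' h x + g' h x"]) (auto intro: has_derivative_add bumps.add)
qed

lemma bumps_eq_0:
  assumes "f \<in> bumps R" "R \<ge> 0" "norm x \<ge> R"
  shows "f x = 0"
  using assms(1)
proof induction
  case (poly p n)
  have "R\<^sup>2 \<le> x \<bullet> x"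
    using assms by (simp add: power2_norm_eq_inner[symmetric])
  then show ?case by (simp add: flat_def)
qed simp

lemma smooth_closedI:
  assumes "f \<in> S" "\<And>f. f \<in> S \<Longrightarrow> f differentiable_on UNIV"
    and "\<And>f b. f \<in> S \<Longrightarrow> b \<in> Basis \<Longrightarrow> (\<lambda>x. frechet_derivative f (at x) b) \<in> S"
  shows "smooth f"
proof -
  have "iter_partial bs f \<in> S" if "set bs \<subseteq> Basis" for bs
    using that by (induction bs) (use assms in auto)
  then show ?thesis
    using assms(2) by (auto simp: smooth_def)
qed

lemma bumps_test_functions:
  assumes "f \<in> bumps R" "R \<ge> 0"
  shows "f \<in> test_functions"
proof -
  have "smooth f"
  proof (rule smooth_closedI[OF assms(1)])
    fix f :: "'a \<Rightarrow> complex" assume "f \<in> bumps R"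
    then obtain f' where f': "\<And>x. (f has_derivative (\<lambda>h. f' h x)) (at x)" "\<And>h. f' h \<in> bumps R"
      using bumps_has_derivative by blast
    then show "f differentiable_on UNIV"
      by (auto simp: differentiable_on_def differentiable_def)
    have "frechet_derivative f (at x) = (\<lambda>h. f' h x)" for x
      using frechet_derivative_at[OF f'(1)] by simp
    then show "(\<lambda>x. frechet_derivative f (at x) b) \<in> bumps R" for b
      using f'(2) by simp
  qed
  moreover have "closure {x. f x \<noteq> 0} \<subseteq> cball 0 R"
    by (rule closure_minimal)
      (use bumps_eq_0[OF assms] nle_le in \<open>force+\<close>)
  then have "compact (closure {x. f x \<noteq> 0})"
    by (metis compact_Int_closed compact_cball closed_closure inf.absorb2)
  ultimately show ?thesis
    by (simp add: test_functions_def)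
qed

section \<open>Supports, bounds and derivatives of test functions\<close>

lemma iter_partial_append: "iter_partial (bs @ cs) f = iter_partial bs (iter_partial cs f)"
  by (induction bs) auto

lemma test_functions_support:
  assumes "\<phi> \<in> test_functions"
  obtains R where "R > 0" "\<And>x. norm x > R \<Longrightarrow> \<phi> x = 0"
proof -
  have "bounded {x. \<phi> x \<noteq> 0}"
    using assms bounded_subset[OF compact_imp_bounded closure_subset]
    by (auto simp: test_functions_def)
  then obtain R where "R > 0" "\<forall>x\<in>{x. \<phi> x \<noteq> 0}. norm x \<le> R"
    by (meson bounded_pos)
  then show ?thesis
    by (intro that[of R]) force+
qed

lemma test_functions_partial:
  assumes "\<phi> \<in> test_functions" "b \<in> Basis"
  shows "iter_partial [b] \<phi> \<in> test_functions"
proof -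
  have "smooth (iter_partial [b] \<phi>)"
    unfolding smooth_def iter_partial_append[symmetric]
    using assms by (auto simp: test_functions_def smooth_def)
  \<comment> \<open>Off the closed support \<open>\<phi>\<close> vanishes on a whole neighbourhood,
    so its derivative vanishes there too and the support does not grow.\<close>
  moreover have "iter_partial [b] \<phi> x = 0" if "x \<notin> closure {x. \<phi> x \<noteq> 0}" for x
  proof -
    have "((\<lambda>_. 0) has_derivative (\<lambda>_. 0)) (at x)" by simp
    then have "(\<phi> has_derivative (\<lambda>_. 0)) (at x)"
      by (rule has_derivative_transform_within_open[where s="- closure {x. \<phi> x \<noteq> 0}"])
        (use that closure_subset in \<open>force+\<close>)
    from frechet_derivative_at[OF this] show ?thesis
      by (simp flip: fun_eq_iff) metis
  qed
  then have "closure {x. iter_partial [b] \<phi> x \<noteq> 0} \<subseteq> closure {x. \<phi> x \<noteq> 0}"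
    by (intro closure_minimal) auto
  then have "compact (closure {x. iter_partial [b] \<phi> x \<noteq> 0})"
    using assms(1) unfolding test_functions_def
    by (metis (lifting) closed_closure mem_Collect_eq compact_Int_closed inf.absorb2)
  ultimately show ?thesis
    unfolding test_functions_def by blast
qed

lemma test_functions_iter_partial_has_derivative:
  assumes "\<phi> \<in> test_functions" "set bs \<subseteq> Basis"
  shows "(iter_partial bs \<phi> has_derivative frechet_derivative (iter_partial bs \<phi>) (at x)) (at x)"
proof -
  have "iter_partial bs \<phi> differentiable_on UNIV"
    using assms by (simp add: test_functions_def smooth_def)
  then have "iter_partial bs \<phi> differentiable (at x)"
    by (simp add: differentiable_on_def)
  then show ?thesis
    by (rule frechet_derivative_works[THEN iffD1])
qed

lemmas test_functions_has_derivative =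
  test_functions_iter_partial_has_derivative[where bs="[]", simplified]

lemma test_functions_continuous:
  assumes "\<phi> \<in> test_functions"
  shows "continuous_on A \<phi>"
  using test_functions_has_derivative[OF assms] has_derivative_continuous
  by (metis continuous_at_imp_continuous_on)

lemma test_functions_bounded:
  assumes "\<phi> \<in> test_functions"
  obtains M where "M > 0" "\<And>x. norm (\<phi> x) \<le> M"
proof -
  obtain R where R: "R > 0" "\<And>x. norm x > R \<Longrightarrow> \<phi> x = 0"
    using test_functions_support[OF assms] by blast
  have "bounded (\<phi> ` cball 0 R)"
    by (intro compact_imp_bounded compact_continuous_image test_functions_continuous assms) auto
  then obtain M where M: "M > 0" "\<forall>x\<in>cball 0 R. norm (\<phi> x) \<le> M"
    by (auto simp: bounded_pos)
  have "norm (\<phi> x) \<le> M" for x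
    using M R(2)[of x] by (cases "norm x > R") auto
  with M show ?thesis using that by blast
qed

lemma test_functions_reflect:
  assumes "\<phi> \<in> test_functions"
  shows "(\<lambda>y. \<phi> (x - y)) \<in> test_functions"
    and "set bs \<subseteq> Basis \<Longrightarrow>
      iter_partial bs (\<lambda>y. \<phi> (x - y)) = (\<lambda>y. (-1) ^ length bs * iter_partial bs \<phi> (x - y))"
proof -
  note diff = test_functions_iter_partial_has_derivative[OF assms]
  have D: "((\<lambda>y. (-1) ^ n * iter_partial bs \<phi> (x - y)) has_derivative
      (\<lambda>h. (-1) ^ n * frechet_derivative (iter_partial bs \<phi>) (at (x - y)) (- h))) (at y)"
    if "set bs \<subseteq> Basis" for bs n y
    by (intro has_derivative_mult_right has_derivative_compose[where f="\<lambda>y. x - y", OF _ diff[OF that]])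
      (auto intro!: derivative_eq_intros)
  show *: "iter_partial bs (\<lambda>y. \<phi> (x - y)) = (\<lambda>y. (-1) ^ length bs * iter_partial bs \<phi> (x - y))"
    if "set bs \<subseteq> Basis" for bs
    using that
  proof (induction bs)
    case (Cons b bs)
    then have bs: "set bs \<subseteq> Basis" by simp
    have lin: "linear (frechet_derivative (iter_partial bs \<phi>) (at z))" for z
      using diff[OF bs] by (rule has_derivative_linear)
    show ?case
      using frechet_derivative_at[OF D[OF bs, of "length bs"], symmetric] Cons bs
      by (simp add: linear_neg[OF lin])
  qed simp
  have "smooth (\<lambda>y. \<phi> (x - y))"
    unfolding smooth_def
  proof (intro allI impI)
    fix bs :: "'a list" assume "set bs \<subseteq> Basis"
    then show "iter_partial bs (\<lambda>y. \<phi> (x - y)) differentiable_on UNIV"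
      unfolding *[OF \<open>set bs \<subseteq> Basis\<close>] differentiable_on_def differentiable_def
      using has_derivative_at_withinI[OF D] by blast
  qed
  moreover obtain R where R: "R > 0" "\<And>x. norm x > R \<Longrightarrow> \<phi> x = 0"
    using test_functions_support[OF assms] by blast
  have "{y. \<phi> (x - y) \<noteq> 0} \<subseteq> cball x R"
    using R by (force simp: dist_norm)
  then have "bounded {y. \<phi> (x - y) \<noteq> 0}"
    using bounded_subset by blast
  ultimately show "(\<lambda>y. \<phi> (x - y)) \<in> test_functions"
    by (simp add: test_functions_def compact_closure)
qed

section \<open>The fundamental lemma of the calculus of variations\<close>

lemma locally_integrable_measurable:
  assumes "locally_integrable f"
  shows "f \<in> borel_measurable lebesgue"
proof (rule borel_measurable_LIMSEQ_metric)
  fix n :: nat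
  show "(\<lambda>x. indicat_real (cball 0 (real n)) x *\<^sub>R f x) \<in> borel_measurable lebesgue"
    using assms by (auto simp: locally_integrable_def set_integrable_def dest!: spec[of _ "cball 0 (real n)"])
next
  fix x :: 'a
  have "\<forall>\<^sub>F n in sequentially. norm x \<le> real n"
    using eventually_ge_at_top[of "nat \<lceil>norm x\<rceil>"] by eventually_elim linarith
  then show "(\<lambda>n. indicat_real (cball 0 (real n)) x *\<^sub>R f x) \<longlonglongrightarrow> f x"
    by (intro tendsto_eventually) (auto elim!: eventually_mono)
qed

lemma locally_integrable_cball:
  assumes "locally_integrable f"
  shows "integrable lebesgue (\<lambda>x. indicat_real (cball c R) x *\<^sub>R f x)"
  using assms compact_cball unfolding locally_integrable_def set_integrable_def by blast

lemma locally_integrable_integrable_mult: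
  assumes f: "locally_integrable f" and h: "h \<in> borel_measurable lebesgue"
    and M: "\<And>x. norm (h x) \<le> M" and R: "\<And>x. norm x > R \<Longrightarrow> h x = 0"
  shows "integrable lebesgue (\<lambda>x. f x * h x)"
proof (rule Bochner_Integration.integrable_bound)
  show "integrable lebesgue (\<lambda>x. M * norm (indicat_real (cball 0 R) x *\<^sub>R f x))"
    by (intro integrable_mult_right integrable_norm locally_integrable_cball f)
  show "(\<lambda>x. f x * h x) \<in> borel_measurable lebesgue"
    using locally_integrable_measurable[OF f] h by measurable
  have "M \<ge> 0" using M[of 0] norm_ge_zero order_trans by blast
  have "norm (f x * h x) \<le> norm (M * norm (indicat_real (cball 0 R) x *\<^sub>R f x))" for x
  proof (cases "norm x > R")
    case False
    then show ?thesis
      using mult_left_mono[OF M[of x], of "norm (f x)"] \<open>M \<ge> 0\<close>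
      by (simp add: norm_mult mult.commute)
  qed (simp add: R)
  then show "AE x in lebesgue. norm (f x * h x) \<le> norm (M * norm (indicat_real (cball 0 R) x *\<^sub>R f x))"
    by simp
qed

text \<open>Measurability supplies continuous approximants without a uniform bound. Composing them
  with the projection onto the closed disc of radius \<open>C\<close> enforces the bound; it keeps
  continuity, and it keeps the limit because \<open>f\<close> takes its values in the disc, where
  the projection is the identity.\<close>

lemma bounded_measurable_approx:
  fixes f :: "'a::euclidean_space \<Rightarrow> complex"
  assumes f: "f \<in> borel_measurable lebesgue" and C: "\<And>x. norm (f x) \<le> C"
  obtains G where "\<And>n::nat. continuous_on UNIV (G n)" "\<And>n x. norm (G n x) \<le> C"
    "AE x in lebesgue. (\<lambda>n. G n x) \<longlonglongrightarrow> f x"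
proof -
  have "C \<ge> 0" using C[of 0] norm_ge_zero order_trans by blast
  have "f measurable_on UNIV"
    using f by (intro lebesgue_measurable_imp_measurable_on) (auto simp: lebesgue_on_UNIV_eq)
  then obtain N g where N: "negligible N" and g: "\<And>n::nat. continuous_on UNIV (g n)"
    and lim: "\<And>x. x \<notin> N \<Longrightarrow> (\<lambda>n. g n x) \<longlonglongrightarrow> f x"
    unfolding measurable_on_def by force
  let ?c = "closest_point (cball (0::complex) C)"
  have cont: "continuous_on UNIV ?c"
    using \<open>C \<ge> 0\<close> by (intro continuous_on_closest_point) auto
  show thesis
  proof (rule that[of "\<lambda>n x. ?c (g n x)"])
    show "continuous_on UNIV (\<lambda>x. ?c (g n x))" for n
      by (rule continuous_on_compose2[OF cont g]) auto
    show "norm (?c (g n x)) \<le> C" for n x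
      using closest_point_in_set[of "cball (0::complex) C" "g n x"] \<open>C \<ge> 0\<close> by auto
    have "(\<lambda>n. ?c (g n x)) \<longlonglongrightarrow> f x" if "x \<notin> N" for x
    proof -
      have "(\<lambda>n. ?c (g n x)) \<longlonglongrightarrow> ?c (f x)"
        using cont lim[OF that] by (intro continuous_on_tendsto_compose[OF cont]) auto
      then show ?thesis
        using C[of x] by (simp add: closest_point_self)
    qed
    then show "AE x in lebesgue. (\<lambda>n. ?c (g n x)) \<longlonglongrightarrow> f x"
      using N by (intro AE_I'[of N]) (auto simp: negligible_iff_null_sets)
  qed
qed

lemma measurable_lebesgue_continuous:
  fixes f :: "'a::euclidean_space \<Rightarrow> 'b::topological_space"
  assumes "continuous_on UNIV f"
  shows "f \<in> borel_measurable lebesgue"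
  using assms by (intro measurable_completion) (simp add: borel_measurable_continuous_onI)

text \<open>On each ball the class of multipliers is enlarged in stages. A polynomial times the bump
  \<open>\<phi>\<close> is a test function; Stone-Weierstrass on the closed ball passes to real
  continuous multipliers, which suffices since \<open>\<phi>\<close> vanishes outside; real and
  imaginary parts give complex ones; bounded a.e. approximation reaches
  \<open>m = cnj (sgn g)\<close>. For this \<open>m\<close> the integrand is
  \<open>|g| \<phi>\<close>, and \<open>\<phi>\<close> is positive on the open ball.\<close>

lemma du_Bois_Reymond:
  fixes g :: "'a::euclidean_space \<Rightarrow> complex"
  assumes g: "locally_integrable g"
    and 0: "\<And>\<phi>. \<phi> \<in> test_functions \<Longrightarrow> (LINT x|lebesgue. g x * \<phi> x) = 0"
  shows "AE x in lebesgue. g x = 0"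
proof -
  have meas_g: "g \<in> borel_measurable lebesgue"
    using g by (rule locally_integrable_measurable)
  have "AE x in lebesgue. norm x < R \<longrightarrow> g x = 0" if "R > 0" for R :: real
  proof -
    define \<phi> where "\<phi> x = flat 0 (R\<^sup>2 - x \<bullet> x)" for x :: 'a
    have \<phi>0: "\<phi> x = 0" if "norm x \<ge> R" for x
    proof -
      have "R\<^sup>2 \<le> x \<bullet> x"
        using that \<open>R > 0\<close> by (simp add: power2_norm_eq_inner[symmetric])
      then show ?thesis by (simp add: \<phi>_def flat_def)
    qed
    have \<phi>1: "0 \<le> \<phi> x" "\<phi> x \<le> 1" for x
      by (auto simp: \<phi>_def flat_def)
    have \<phi>cont: "continuous_on UNIV \<phi>"
      unfolding \<phi>_def
      by (rule continuous_on_compose2[where f="\<lambda>x. R\<^sup>2 - x \<bullet> x" and t=UNIV])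
        (auto intro!: continuous_intros DERIV_continuous_on flat_has_real_derivative)
    note [measurable] = meas_g measurable_lebesgue_continuous[OF \<phi>cont]
    have poly: "(LINT x|lebesgue. g x * of_real (p x * \<phi> x)) = 0" if "real_polynomial_function p" for p
      unfolding \<phi>_def using that \<open>R > 0\<close>
      by (intro 0 bumps_test_functions[where R=R] bumps.intros) auto
    have real: "(LINT x|lebesgue. g x * of_real (c x * \<phi> x)) = 0"
      and real_int: "integrable lebesgue (\<lambda>x. g x * of_real (c x * \<phi> x))"
      if c: "continuous_on UNIV c" for c :: "'a \<Rightarrow> real"
    proof -
      have "bounded (c ` cball 0 R)"
        by (intro compact_imp_bounded compact_continuous_image continuous_on_subset[OF c]) auto
      then obtain C where C: "C > 0" "\<And>x. x \<in> cball 0 R \<Longrightarrow> \<bar>c x\<bar> \<le> C"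
        by (auto simp: bounded_pos)
      have "\<exists>p. real_polynomial_function p \<and> (\<forall>x\<in>cball 0 R. \<bar>c x - p x\<bar> < 1 / Suc n)" for n
      proof -
        obtain p where "real_polynomial_function p" "\<And>x. x \<in> cball 0 R \<Longrightarrow> \<bar>c x - p x\<bar> < 1 / Suc n"
          by (rule Stone_Weierstrass_real_polynomial_function
              [of "cball 0 R" c "1 / Suc n"]) (use continuous_on_subset[OF c] in auto)
        then show ?thesis by blast
      qed
      then obtain p where p: "\<And>n. real_polynomial_function (p n)"
        and pc: "\<And>n x. x \<in> cball 0 R \<Longrightarrow> \<bar>c x - p n x\<bar> < 1 / Suc n"
        by metis
      have pcont: "continuous_on UNIV (p n)" for n
        using p continuous_on_polymonial_function real_polynomial_function_eq by blast
      note [measurable] = measurable_lebesgue_continuous[OF c] measurable_lebesgue_continuous[OF pcont]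
      have bd: "\<bar>p n x * \<phi> x\<bar> \<le> C + 1" for n x
      proof (cases "norm x \<ge> R")
        case True then show ?thesis using \<phi>0 C(1) by simp
      next
        case False
        then have "\<bar>c x\<bar> \<le> C" "\<bar>c x - p n x\<bar> < 1 / Suc n"
          using C(2) pc by auto
        moreover have "1 / real (Suc n) \<le> 1"
          by simp
        ultimately have "\<bar>p n x\<bar> \<le> C + 1"
          by linarith
        then show ?thesis
          using mult_mono[of "\<bar>p n x\<bar>" "C + 1" "\<phi> x" 1] \<phi>1[of x] C(1) by (simp add: abs_mult)
      qed
      have bdc: "\<bar>c x * \<phi> x\<bar> \<le> C" for x
      proof (cases "norm x \<ge> R")
        case False
        then show ?thesis
          using mult_mono[of "\<bar>c x\<bar>" "C" "\<phi> x" 1] \<phi>1[of x] C(1) C(2)[of x] by (simp add: abs_mult)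
      qed (use \<phi>0 C(1) in simp)
      show "integrable lebesgue (\<lambda>x. g x * of_real (c x * \<phi> x))"
        by (rule locally_integrable_integrable_mult[OF g, where M=C and R=R])
          (use bdc \<phi>0 in \<open>auto simp: simp del: of_real_mult\<close>)
      have "(\<lambda>n. LINT x|lebesgue. g x * of_real (p n x * \<phi> x)) \<longlonglongrightarrow> (LINT x|lebesgue. g x * of_real (c x * \<phi> x))"
      proof (rule integral_dominated_convergence[where w="\<lambda>x. norm (indicat_real (cball 0 R) x *\<^sub>R g x) * (C + 1)"])
        show "integrable lebesgue (\<lambda>x. norm (indicat_real (cball 0 R) x *\<^sub>R g x) * (C + 1))"
          by (intro integrable_mult_left integrable_norm locally_integrable_cball g)
        show "AE x in lebesgue. (\<lambda>n. g x * complex_of_real (p n x * \<phi> x)) \<longlonglongrightarrow> g x * complex_of_real (c x * \<phi> x)"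
        proof (rule AE_I2)
          fix x
          show "(\<lambda>n. g x * complex_of_real (p n x * \<phi> x)) \<longlonglongrightarrow> g x * complex_of_real (c x * \<phi> x)"
          proof (cases "norm x \<ge> R")
            case False
            have "(\<lambda>n. p n x - c x) \<longlonglongrightarrow> 0"
              by (rule Lim_null_comparison[OF _ LIMSEQ_Suc[OF lim_1_over_n]])
                (use pc[of x] False in \<open>auto simp: abs_minus_commute less_imp_le\<close>)
            then have "(\<lambda>n. p n x) \<longlonglongrightarrow> c x"
              by (simp add: LIM_zero_iff)
            then show ?thesis by (intro tendsto_intros)
          qed (simp add: \<phi>0)
        qed
        show "AE x in lebesgue. norm (g x * complex_of_real (p n x * \<phi> x))
            \<le> norm (indicat_real (cball 0 R) x *\<^sub>R g x) * (C + 1)" for n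
        proof (rule AE_I2)
          fix x
          show "norm (g x * complex_of_real (p n x * \<phi> x))
            \<le> norm (indicat_real (cball 0 R) x *\<^sub>R g x) * (C + 1)"
            using bd[of n x] \<phi>0[of x] C(1)
            by (cases "norm x > R") (auto simp: norm_mult simp flip: abs_mult intro!: mult_left_mono)
        qed
      qed measurable
      then show "(LINT x|lebesgue. g x * of_real (c x * \<phi> x)) = 0"
        unfolding poly[OF p] LIMSEQ_const_iff by simp
    qed
    have complex: "(LINT x|lebesgue. g x * (c x * of_real (\<phi> x))) = 0"
      if c: "continuous_on UNIV c" for c :: "'a \<Rightarrow> complex"
    proof -
      have "(LINT x|lebesgue. g x * (c x * of_real (\<phi> x))) =
        (LINT x|lebesgue. g x * of_real (Re (c x) * \<phi> x) + \<i> * (g x * of_real (Im (c x) * \<phi> x)))"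
        by (intro Bochner_Integration.integral_cong refl)
          (simp add: complex_eq_iff algebra_simps)
      also have "\<dots> = 0"
        using real[OF continuous_on_Re[OF c]] real[OF continuous_on_Im[OF c]]
          real_int[OF continuous_on_Re[OF c]] real_int[OF continuous_on_Im[OF c]]
        by (simp del: of_real_mult)
      finally show ?thesis .
    qed
    define m where "m x = cnj (sgn (g x))" for x
    have [measurable]: "cnj \<in> borel_measurable borel"
      by (intro borel_measurable_continuous_onI continuous_intros)
    have m1: "m \<in> borel_measurable lebesgue"
      unfolding m_def sgn_div_norm by measurable
    have m2: "norm (m x) \<le> 1" for x
      by (simp add: m_def norm_sgn)
    obtain G where G: "\<And>n::nat. continuous_on UNIV (G n)" "\<And>n x. norm (G n x) \<le> 1"
      "AE x in lebesgue. (\<lambda>n. G n x) \<longlonglongrightarrow> m x"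
      using bounded_measurable_approx[OF m1 m2] by blast
    note [measurable] = m1 measurable_lebesgue_continuous[OF G(1)]
    have int: "integrable lebesgue (\<lambda>x. g x * of_real (\<phi> x))"
      using real_int[of "\<lambda>_. 1"] by simp
    have "(\<lambda>n. LINT x|lebesgue. g x * (G n x * of_real (\<phi> x))) \<longlonglongrightarrow> (LINT x|lebesgue. g x * (m x * of_real (\<phi> x)))"
    proof (rule integral_dominated_convergence)
      show "integrable lebesgue (\<lambda>x. norm (g x * of_real (\<phi> x)))"
        using int by simp
      show "AE x in lebesgue. (\<lambda>n. g x * (G n x * of_real (\<phi> x))) \<longlonglongrightarrow> g x * (m x * of_real (\<phi> x))"
        using G(3) by eventually_elim (intro tendsto_intros)
      show "AE x in lebesgue. norm (g x * (G n x * of_real (\<phi> x))) \<le> norm (g x * of_real (\<phi> x))" for n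
        using G(2)[of n] \<phi>1 by (intro AE_I2) (auto simp: norm_mult intro!: mult_left_mono mult_left_le_one_le)
    qed measurable
    then have "(LINT x|lebesgue. g x * (m x * of_real (\<phi> x))) = 0"
      unfolding complex[OF G(1)] LIMSEQ_const_iff by simp
    moreover have "g x * (m x * of_real (\<phi> x)) = of_real (norm (g x) * \<phi> x)" for x
    proof -
      have "g x * (m x * of_real (\<phi> x)) = (g x * cnj (g x)) * of_real (\<phi> x / norm (g x))"
        by (simp add: m_def sgn_eq)
      also have "\<dots> = of_real ((norm (g x))\<^sup>2 * (\<phi> x / norm (g x)))"
        by (simp only: complex_norm_square[symmetric] of_real_mult)
      finally show ?thesis
        by (simp add: power2_eq_square mult.commute)
    qed
    ultimately have "(LINT x|lebesgue. norm (g x) * \<phi> x) = 0"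
      by (simp del: of_real_mult)
    moreover have "integrable lebesgue (\<lambda>x. norm (g x) * \<phi> x)"
      using integrable_norm[OF int] \<phi>1 by (simp add: norm_mult)
    ultimately have "AE x in lebesgue. norm (g x) * \<phi> x = 0"
      using \<phi>1 by (subst (asm) integral_nonneg_eq_0_iff_AE) auto
    then show ?thesis
    proof eventually_elim
      case (elim x)
      have "\<phi> x > 0" if "norm x < R"
      proof -
        have "x \<bullet> x < R\<^sup>2"
          using that \<open>R > 0\<close> by (simp add: power2_norm_eq_inner[symmetric] power_strict_mono)
        then show ?thesis by (simp add: \<phi>_def flat_pos)
      qed
      with elim show ?case by auto
    qed
  qed
  then have "AE x in lebesgue. \<forall>n. norm x < real (Suc n) \<longrightarrow> g x = 0"
    by (intro AE_all_countable[THEN iffD2] allI) simp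
  then show ?thesis
  proof eventually_elim
    case (elim x)
    obtain n where "norm x < real n" using reals_Archimedean2 by blast
    with elim show ?case by (auto dest!: spec[of _ n])
  qed
qed

section \<open>Convolution with test functions\<close>

lemma bounded_support_reflect_eq_0:
  assumes "norm y > R + norm z" "\<And>x. norm x > R \<Longrightarrow> \<phi> x = 0"
  shows "\<phi> (z - y) = 0"
  using assms norm_triangle_ineq2[of y z] by (metis add_less_cancel_right diff_add_cancel norm_minus_commute order_less_le_trans)

lemma test_functions_directional_derivative:
  assumes "\<phi> \<in> test_functions" "b \<in> Basis"
  shows "((\<lambda>t. \<phi> (x + t *\<^sub>R b)) has_vector_derivative iter_partial [b] \<phi> (x + t *\<^sub>R b)) (at t)"
proof -
  let ?D = "frechet_derivative \<phi> (at (x + t *\<^sub>R b))"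
  have "(\<phi> has_derivative ?D) (at (x + t *\<^sub>R b))"
    by (rule test_functions_has_derivative[OF assms(1)])
  then have "((\<lambda>t. \<phi> (x + t *\<^sub>R b)) has_derivative (\<lambda>h. ?D (h *\<^sub>R b))) (at t)"
    by (rule has_derivative_compose[rotated]) (auto intro!: derivative_eq_intros)
  moreover have "linear ?D"
    using test_functions_has_derivative[OF assms(1)] has_derivative_linear by blast
  ultimately show ?thesis
    by (simp add: has_vector_derivative_def linear_scale)
qed

lemma test_functions_difference_bound:
  assumes "\<phi> \<in> test_functions" "b \<in> Basis" "\<And>x. norm (iter_partial [b] \<phi> x) \<le> M"
  shows "norm (\<phi> (x + t *\<^sub>R b) - \<phi> x) \<le> M * \<bar>t\<bar>"
proof -
  have "norm (\<phi> (x + t *\<^sub>R b) - \<phi> (x + 0 *\<^sub>R b)) \<le> M * norm (t - 0)"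
  proof (rule differentiable_bound[where S=UNIV])
    show "((\<lambda>t. \<phi> (x + t *\<^sub>R b)) has_derivative (\<lambda>h. h *\<^sub>R iter_partial [b] \<phi> (x + t *\<^sub>R b))) (at t)" for t
      using test_functions_directional_derivative[OF assms(1,2)]
      unfolding has_vector_derivative_def .
    show "onorm (\<lambda>h. h *\<^sub>R iter_partial [b] \<phi> (x + t *\<^sub>R b)) \<le> M" for t
    proof (rule onorm_le)
      show "norm (h *\<^sub>R iter_partial [b] \<phi> (x + t *\<^sub>R b)) \<le> M * norm h" for h
        using mult_right_mono[OF assms(3) norm_ge_zero[of h]] by (simp only: norm_scaleR real_norm_def mult.commute)
    qed
  qed auto
  then show ?thesis by simp
qed

lemma integrable_mult_test:
  assumes "locally_integrable f" "\<phi> \<in> test_functions"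
  shows "integrable lebesgue (\<lambda>x. f x * \<phi> x)"
proof -
  obtain R where R: "\<And>x. norm x > R \<Longrightarrow> \<phi> x = 0"
    using test_functions_support[OF assms(2)] by blast
  obtain M where M: "\<And>x. norm (\<phi> x) \<le> M"
    using test_functions_bounded[OF assms(2)] by blast
  show ?thesis
    by (rule locally_integrable_integrable_mult[OF assms(1) _ M R])
      (use measurable_lebesgue_continuous test_functions_continuous[OF assms(2)] in auto)
qed

lemma has_vector_derivative_at_0_iff:
  fixes g :: "real \<Rightarrow> 'a::real_normed_vector"
  shows "(g has_vector_derivative D) (at 0) \<longleftrightarrow> ((\<lambda>t. (g t - g 0) /\<^sub>R t) \<longlongrightarrow> D) (at 0)"
proof -
  have "norm (g t - g 0 - t *\<^sub>R D) / norm t = norm ((g t - g 0) /\<^sub>R t - D)" if "t \<noteq> 0" for t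
  proof -
    have "(g t - g 0) /\<^sub>R t - D = (g t - g 0 - t *\<^sub>R D) /\<^sub>R t"
      using that by (simp add: scaleR_right_diff_distrib)
    then show ?thesis by (simp add: divide_inverse mult.commute)
  qed
  then have "((\<lambda>t. norm (g t - g 0 - t *\<^sub>R D) / norm t) \<longlongrightarrow> 0) (at 0) \<longleftrightarrow>
      ((\<lambda>t. norm ((g t - g 0) /\<^sub>R t - D)) \<longlongrightarrow> 0) (at 0)"
    by (intro filterlim_cong refl) (auto simp: eventually_at_filter)
  then show ?thesis
    by (simp add: has_vector_derivative_def has_derivative_at bounded_linear_scaleR_left diff_diff_eq
        tendsto_norm_zero_iff LIM_zero_iff)
qed

definition conv :: "('a::euclidean_space \<Rightarrow> complex) \<Rightarrow> ('a \<Rightarrow> complex) \<Rightarrow> 'a \<Rightarrow> complex" where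
  "conv f \<phi> x = (LINT y|lebesgue. f y * \<phi> (x - y))"

lemma conv_integrable:
  assumes "locally_integrable f" "\<phi> \<in> test_functions"
  shows "integrable lebesgue (\<lambda>y. f y * \<phi> (x - y))"
  using assms by (intro integrable_mult_test test_functions_reflect)

text \<open>A common bounded support allows \<open>f\<close> to be merely locally integrable:
  \<open>M |f|\<close> restricted to the ball dominates. Continuity and differentiability of
  convolutions and the convergence of mollifications all pass through this one limit
  theorem.\<close>

lemma tendsto_integral_mult_bounded_support:
  assumes f: "locally_integrable f"
    and h: "\<And>n. h n \<in> borel_measurable lebesgue" and k: "k \<in> borel_measurable lebesgue"
    and lim: "AE y in lebesgue. (\<lambda>n. h n y) \<longlonglongrightarrow> k y"
    and M: "\<And>n y. norm (h n y) \<le> M" and R: "\<And>n y. norm y > R \<Longrightarrow> h n y = 0"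
  shows "(\<lambda>n. LINT y|lebesgue. f y * h n y) \<longlonglongrightarrow> (LINT y|lebesgue. f y * k y)"
proof (rule integral_dominated_convergence)
  note [measurable] = locally_integrable_measurable[OF f] h k
  show "(\<lambda>y. f y * k y) \<in> borel_measurable lebesgue" "\<And>n. (\<lambda>y. f y * h n y) \<in> borel_measurable lebesgue"
    by measurable
  show "integrable lebesgue (\<lambda>y. norm (indicat_real (cball 0 R) y *\<^sub>R f y) * M)"
    by (intro integrable_mult_left integrable_norm locally_integrable_cball f)
  show "AE y in lebesgue. (\<lambda>n. f y * h n y) \<longlonglongrightarrow> f y * k y"
    using lim by eventually_elim (intro tendsto_intros)
  have "norm (f y * h n y) \<le> norm (indicat_real (cball 0 R) y *\<^sub>R f y) * M" for n y
    using M[of n y] R[where n=n and y=y] by (cases "norm y > R") (auto simp: norm_mult intro!: mult_left_mono)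
  then show "AE y in lebesgue. norm (f y * h n y) \<le> norm (indicat_real (cball 0 R) y *\<^sub>R f y) * M" for n
    by simp
qed

lemma measurable_reflect_test:
  assumes "\<phi> \<in> test_functions"
  shows "(\<lambda>y. \<phi> (x - y)) \<in> borel_measurable lebesgue"
  using assms by (intro measurable_lebesgue_continuous test_functions_continuous test_functions_reflect)

lemma conv_continuous:
  assumes f: "locally_integrable f" and \<phi>: "\<phi> \<in> test_functions"
  shows "continuous_on UNIV (conv f \<phi>)"
proof -
  obtain R where R: "\<And>x. norm x > R \<Longrightarrow> \<phi> x = 0"
    using test_functions_support[OF \<phi>] by blast
  obtain M where M: "\<And>x. norm (\<phi> x) \<le> M"
    using test_functions_bounded[OF \<phi>] by blast
  have "(\<lambda>n. conv f \<phi> (s n)) \<longlonglongrightarrow> conv f \<phi> x" if s: "s \<longlonglongrightarrow> x" for s x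
  proof -
    obtain K where K: "\<And>n. norm (s n) \<le> K"
      using convergent_imp_Bseq[OF convergentI[OF s]] by (auto simp: Bseq_def)
    show ?thesis
      unfolding conv_def
    proof (rule tendsto_integral_mult_bounded_support[OF f _ _ _ _])
      show "\<phi> (s n - y) = 0" if "norm y > R + K" for n y
        using that K[of n] by (intro bounded_support_reflect_eq_0[OF _ R]) auto
      show "AE y in lebesgue. (\<lambda>n. \<phi> (s n - y)) \<longlonglongrightarrow> \<phi> (x - y)"
        using test_functions_continuous[OF \<phi>, of UNIV]
        by (intro AE_I2 continuous_on_tendsto_compose[where f=\<phi>]) (auto intro!: tendsto_intros s)
    qed (use M measurable_reflect_test[OF \<phi>] in auto)
  qed
  then show ?thesis
    by (simp add: continuous_on_sequentially o_def)
qed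

text \<open>Differentiation falls on the smooth factor. The mean value inequality bounds all
  difference quotients of \<open>\<phi>\<close> by the supremum of its partial derivative, and for
  bounded \<open>t\<close> their supports lie in one ball, so dominated convergence applies along
  every sequence tending to 0.\<close>

lemma conv_directional_derivative:
  assumes f: "locally_integrable f" and \<phi>: "\<phi> \<in> test_functions" and b: "b \<in> Basis"
  shows "((\<lambda>t. conv f \<phi> (x + t *\<^sub>R b)) has_vector_derivative conv f (iter_partial [b] \<phi>) x) (at 0)"
proof -
  let ?d = "iter_partial [b] \<phi>"
  have d: "?d \<in> test_functions"
    by (rule test_functions_partial[OF \<phi> b])
  obtain R where R: "R > 0" "\<And>x. norm x > R \<Longrightarrow> \<phi> x = 0"
    using test_functions_support[OF \<phi>] by blast
  obtain M where M: "\<And>x. norm (?d x) \<le> M"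
    using test_functions_bounded[OF d] by blast
  define q where "q t y = (\<phi> (x + t *\<^sub>R b - y) - \<phi> (x - y)) /\<^sub>R t" for t y
  have lim: "((\<lambda>t. q t y) \<longlongrightarrow> ?d (x - y)) (at 0)" for y
    using test_functions_directional_derivative[OF \<phi> b, of "x - y" 0]
    unfolding has_vector_derivative_at_0_iff q_def by (simp add: algebra_simps del: iter_partial.simps scaleR_right_diff_distrib)
  have "((\<lambda>t. LINT y|lebesgue. f y * q t y) \<longlongrightarrow> conv f ?d x) (at 0)"
    unfolding tendsto_at_iff_sequentially o_def
  proof (intro allI impI)
    fix X :: "nat \<Rightarrow> real" assume X0: "\<forall>i. X i \<in> UNIV - {0}" and X: "X \<longlonglongrightarrow> 0"
    obtain K where K: "\<And>n. norm (X n) \<le> K"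
      using convergent_imp_Bseq[OF convergentI[OF X]] by (auto simp: Bseq_def)
    show "(\<lambda>n. LINT y|lebesgue. f y * q (X n) y) \<longlonglongrightarrow> conv f ?d x"
      unfolding conv_def
    proof (rule tendsto_integral_mult_bounded_support[OF f])
      show "q (X n) \<in> borel_measurable lebesgue" for n
        unfolding q_def by (intro borel_measurable_scaleR borel_measurable_diff borel_measurable_const
            measurable_reflect_test \<phi>)
      show "(\<lambda>y. ?d (x - y)) \<in> borel_measurable lebesgue"
        by (rule measurable_reflect_test[OF d])
      show "AE y in lebesgue. (\<lambda>n. q (X n) y) \<longlonglongrightarrow> ?d (x - y)"
        using lim X X0 unfolding tendsto_at_iff_sequentially o_def by blast
      show "norm (q (X n) y) \<le> M" for n y
      proof -
        have "norm (\<phi> (x + X n *\<^sub>R b - y) - \<phi> (x - y)) \<le> M * \<bar>X n\<bar>"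
          using test_functions_difference_bound[OF \<phi> b M, of "x - y" "X n"] by (simp add: algebra_simps)
        then show ?thesis
          unfolding q_def norm_scaleR using X0 by (simp add: field_simps)
      qed
      \<comment> \<open>Since \<open>b\<close> has norm 1, the points
        \<open>x + X n *\<^sub>R b\<close> stay in the ball of radius \<open>norm x + K\<close>;
        adding the support radius \<open>R\<close> gives a ball that works for every
        \<open>n\<close>.\<close>
      show "q (X n) y = 0" if "norm y > R + (norm x + K)" for n y
      proof -
        have "norm (x + X n *\<^sub>R b) \<le> norm x + K"
          using norm_triangle_ineq[of x "X n *\<^sub>R b"] K[of n] b by simp
        moreover have "K \<ge> 0" using K[of 0] norm_ge_zero order_trans by blast
        ultimately have "\<phi> (x + X n *\<^sub>R b - y) = 0" "\<phi> (x - y) = 0"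
          using that by (auto intro!: bounded_support_reflect_eq_0[OF _ R(2)])
        then show ?thesis by (simp add: q_def)
      qed
    qed
  qed
  moreover have "(LINT y|lebesgue. f y * q t y) = (conv f \<phi> (x + t *\<^sub>R b) - conv f \<phi> x) /\<^sub>R t" for t
  proof -
    have "(LINT y|lebesgue. f y * q t y) =
        (LINT y|lebesgue. (f y * \<phi> (x + t *\<^sub>R b - y) - f y * \<phi> (x - y)) /\<^sub>R t)"
      by (simp add: q_def algebra_simps)
    also have "\<dots> = (conv f \<phi> (x + t *\<^sub>R b) - conv f \<phi> x) /\<^sub>R t"
      by (simp add: conv_def conv_integrable[OF f \<phi>] del: scaleR_right_diff_distrib)
    finally show ?thesis .
  qed
  ultimately show ?thesis
    by (simp add: has_vector_derivative_at_0_iff)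
qed

text \<open>The reflected function \<open>y \<mapsto> \<phi> (x - y)\<close> is itself an admissible
  test function. Each derivative of it brings a factor -1 from the chain rule, which cancels the
  sign in the definition of the weak derivative.\<close>

lemma conv_weak_derivative:
  assumes "has_weak_derivative bs u g" "\<phi> \<in> test_functions" "set bs \<subseteq> Basis"
  shows "conv u (iter_partial bs \<phi>) x = conv g \<phi> x"
proof -
  let ?\<psi> = "\<lambda>y. \<phi> (x - y)" and ?s = "(-1) ^ length bs :: complex"
  have "?s * conv u (iter_partial bs \<phi>) x = (LINT y|lebesgue. u y * iter_partial bs ?\<psi> y)"
    using test_functions_reflect(2)[OF assms(2,3)]
    by (simp add: conv_def mult.left_commute flip: integral_mult_right_zero)
  also have "\<dots> = ?s * conv g \<phi> x"
    using assms(1) test_functions_reflect(1)[OF assms(2)]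
    unfolding has_weak_derivative_def conv_def by blast
  finally show ?thesis by simp
qed

section \<open>The Rellich inequality with a regularised weight\<close>

lemma lborel_translate:
  fixes f :: "'a::euclidean_space \<Rightarrow> real"
  assumes [measurable]: "f \<in> borel_measurable borel"
  shows "integrable lborel (\<lambda>x. f (x + c)) \<longleftrightarrow> integrable lborel f"
    and "(LINT x|lborel. f (x + c)) = (LINT x|lborel. f x)"
proof -
  have "integrable (distr lborel borel ((+) c)) f \<longleftrightarrow> integrable lborel (\<lambda>x. f (c + x))"
    by (intro integrable_distr_eq) auto
  then show "integrable lborel (\<lambda>x. f (x + c)) \<longleftrightarrow> integrable lborel f"
    by (simp add: lborel_distr_plus add.commute)
  have "(LINT x|distr lborel borel ((+) c). f x) = (LINT x|lborel. f (c + x))"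
    by (intro integral_distr) auto
  then show "(LINT x|lborel. f (x + c)) = (LINT x|lborel. f x)"
    by (simp add: lborel_distr_plus add.commute)
qed

text \<open>Integration by parts without boundary terms. The integral of
  \<open>F (x + b) - F x\<close> is 0 by translation invariance; by the fundamental theorem of
  calculus on the segment and Fubini it is also the average over \<open>t\<close> in
  \<open>[0, 1]\<close> of the integrals of \<open>F' (x + t *\<^sub>R b)\<close>, each equal to the
  integral of \<open>F'\<close>. Integrability of \<open>F\<close> and \<open>F'\<close> thus takes
  the place of compact support.\<close>

lemma integral_directional_derivative_eq_0:
  fixes F F' :: "'a::euclidean_space \<Rightarrow> real"
  assumes deriv: "\<And>x. ((\<lambda>t. F (x + t *\<^sub>R b)) has_real_derivative F' x) (at 0)"
    and cont: "continuous_on UNIV F'"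
    and F: "integrable lborel F" and F': "integrable lborel F'"
  shows "(LINT x|lborel. F' x) = 0"
proof -
  have [measurable]: "F' \<in> borel_measurable borel"
    using cont by (rule borel_measurable_continuous_onI)
  have [measurable]: "F \<in> borel_measurable borel"
    using F by (auto dest: borel_measurable_integrable)
  have D: "((\<lambda>t. F (x + t *\<^sub>R b)) has_real_derivative F' (x + t *\<^sub>R b)) (at t)" for x t
    using deriv[of "x + t *\<^sub>R b"] DERIV_shift[of "\<lambda>t. F (x + t *\<^sub>R b)" _ 0 t]
    by (simp add: algebra_simps)
  define g where "g t x = F' (x + t *\<^sub>R b) * indicat_real {0..1} t" for t :: real and x
  have g_meas: "(\<lambda>(t, x). g t x) \<in> borel_measurable (lborel \<Otimes>\<^sub>M lborel)"
    unfolding g_def by measurable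
  have g_int: "integrable (lborel \<Otimes>\<^sub>M lborel) (\<lambda>(t, x). g t x)"
  proof (rule lborel_pair.Fubini_integrable[OF g_meas])
    have "(LINT x|lborel. norm (case (t, x) of (t, x) \<Rightarrow> g t x)) =
        (LINT x|lborel. \<bar>F' x\<bar>) * indicat_real {0..1} t" for t
      using lborel_translate(2)[of "\<lambda>x. \<bar>F' x\<bar>" "t *\<^sub>R b"] by (simp add: g_def abs_mult)
    then show "integrable lborel (\<lambda>t. LINT x|lborel. norm (case (t, x) of (t, x) \<Rightarrow> g t x))"
      by simp
    show "AE t in lborel. integrable lborel (\<lambda>x. case (t, x) of (t, x) \<Rightarrow> g t x)"
      using lborel_translate(1)[of F'] F' by (auto simp: g_def)
  qed
  have "(LINT x|lborel. (LINT t|lborel. g t x)) = (LINT t|lborel. (LINT x|lborel. g t x))"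
    by (rule lborel_pair.Fubini_integral[OF g_int])
  moreover have "(LINT t|lborel. g t x) = F (x + b) - F x" for x
  proof -
    have "(LINT t|lborel. g t x) = F (x + 1 *\<^sub>R b) - F (x + 0 *\<^sub>R b)"
      unfolding g_def
    proof (rule integral_FTC_Icc_real)
      show "isCont (\<lambda>t. F' (x + t *\<^sub>R b)) t" for t
        by (rule continuous_on_interior[of UNIV])
          (auto intro!: continuous_on_compose2[OF cont] continuous_intros)
    qed (use D in auto)
    then show ?thesis by simp
  qed
  moreover have "(LINT t|lborel. (LINT x|lborel. g t x)) = (LINT x|lborel. F' x)"
    using lborel_translate(2)[of F'] by (simp add: g_def)
  moreover have "(LINT x|lborel. F (x + b) - F x) = 0"
    using F by (simp add: lborel_translate)
  ultimately show ?thesis by simp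
qed

lemma integrable_weighted_inner:
  fixes p q :: "'a::euclidean_space \<Rightarrow> complex"
  assumes "continuous_on UNIV w" "\<And>x. \<bar>w x\<bar> \<le> K"
    and "continuous_on UNIV p" "integrable lborel (\<lambda>x. (cmod (p x))\<^sup>2)"
    and "continuous_on UNIV q" "integrable lborel (\<lambda>x. (cmod (q x))\<^sup>2)"
  shows "integrable lborel (\<lambda>x. w x * (p x \<bullet> q x))"
proof (rule Bochner_Integration.integrable_bound)
  show "integrable lborel (\<lambda>x. K * ((cmod (p x))\<^sup>2 + (cmod (q x))\<^sup>2))"
    using assms by auto
  have "continuous_on UNIV (\<lambda>x. w x * (p x \<bullet> q x))"
    by (intro continuous_intros assms)
  then show "(\<lambda>x. w x * (p x \<bullet> q x)) \<in> borel_measurable lborel"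
    by (simp add: borel_measurable_continuous_onI)
  have "norm (w x * (p x \<bullet> q x)) \<le> norm (K * ((cmod (p x))\<^sup>2 + (cmod (q x))\<^sup>2))" for x
  proof -
    have "\<bar>p x \<bullet> q x\<bar> \<le> cmod (p x) * cmod (q x)"
      by (rule Cauchy_Schwarz_ineq2)
    also have "\<dots> \<le> (cmod (p x))\<^sup>2 + (cmod (q x))\<^sup>2"
      using sum_squares_bound[of "cmod (p x)" "cmod (q x)"]
        mult_nonneg_nonneg[OF norm_ge_zero[of "p x"] norm_ge_zero[of "q x"]] by linarith
    finally have "\<bar>p x \<bullet> q x\<bar> \<le> (cmod (p x))\<^sup>2 + (cmod (q x))\<^sup>2" .
    moreover have "K \<ge> 0" using assms(2)[of x] by linarith
    ultimately show ?thesis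
      using mult_mono[OF assms(2)[of x], of "\<bar>p x \<bullet> q x\<bar>"] by (simp add: abs_mult)
  qed
  then show "AE x in lborel. norm (w x * (p x \<bullet> q x)) \<le> norm (K * ((cmod (p x))\<^sup>2 + (cmod (q x))\<^sup>2))"
    by simp
qed

text \<open>The form of the hypotheses is what mollifications of an \<open>H^2\<close> function
  provide: continuous square integrable derivatives along the basis directions, with only the pure
  second derivatives that make up the Laplacian. The proof bounds the divergence of a vector field
  from below pointwise and uses that its integral is 0.\<close>

lemma rellich_regularised:
  fixes u :: "'a::euclidean_space \<Rightarrow> complex" and u1 u2 :: "'a \<Rightarrow> 'a \<Rightarrow> complex"
  assumes dim: "DIM('a) \<ge> 5" and \<epsilon>: "\<epsilon> > 0"
    and u: "continuous_on UNIV u" "integrable lborel (\<lambda>x. (cmod (u x))\<^sup>2)"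
    and u1: "\<And>b. b \<in> Basis \<Longrightarrow> continuous_on UNIV (u1 b)"
      "\<And>b. b \<in> Basis \<Longrightarrow> integrable lborel (\<lambda>x. (cmod (u1 b x))\<^sup>2)"
    and u2: "\<And>b. b \<in> Basis \<Longrightarrow> continuous_on UNIV (u2 b)"
      "\<And>b. b \<in> Basis \<Longrightarrow> integrable lborel (\<lambda>x. (cmod (u2 b x))\<^sup>2)"
    and du: "\<And>b x. b \<in> Basis \<Longrightarrow> ((\<lambda>t. u (x + t *\<^sub>R b)) has_vector_derivative u1 b x) (at 0)"
    and du1: "\<And>b x. b \<in> Basis \<Longrightarrow> ((\<lambda>t. u1 b (x + t *\<^sub>R b)) has_vector_derivative u2 b x) (at 0)"
  shows "rellich_constant DIM('a) * (LINT x|lborel. (cmod (u x))\<^sup>2 / (x \<bullet> x + \<epsilon>)\<^sup>2)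
    \<le> (LINT x|lborel. (cmod (\<Sum>b\<in>Basis. u2 b x))\<^sup>2)"
proof -
  define d where "d = real DIM('a)"
  define c where "c = (d - 2) / 2"
  define k where "k = d * (d - 4) / 4"
  have d: "d \<ge> 5" using dim by (simp add: d_def)
  have k: "k > 0" using d by (simp add: k_def)
  define m where "m x = inverse (x \<bullet> x + \<epsilon>)" for x :: 'a
  define y where "y b x = (x \<bullet> b) * m x" for b x :: 'a
  have pos: "x \<bullet> x + \<epsilon> > 0" for x :: 'a
    using \<epsilon> inner_ge_zero[of x] by linarith
  have m0: "m x > 0" for x using pos by (simp add: m_def)
  have m_cont: "continuous_on UNIV m"
    unfolding m_def using pos by (auto intro!: continuous_intros simp: less_imp_neq[symmetric])
  have y_cont: "continuous_on UNIV (y b)" for b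
    unfolding y_def by (intro continuous_intros m_cont)
  \<comment> \<open>One bound for both weights:
    \<open>|x \<bullet> b| \<le> norm x \<le> 1 + x \<bullet> x\<close>, and multiplying by
    \<open>m\<close> gives at most \<open>1 + 1 / \<epsilon>\<close>.\<close>
  define K where "K = 1 + 1 / \<epsilon>"
  have K: "K > 0" using \<epsilon> by (simp add: K_def add_pos_pos)
  have xm: "(x \<bullet> x) * m x \<le> 1" for x
    using \<epsilon> pos[of x] by (simp add: m_def field_simps)
  have me: "m x \<le> 1 / \<epsilon>" for x
    unfolding m_def using \<epsilon> by (simp add: field_simps add_pos_nonneg pos)
  have mK: "\<bar>m x\<bar> \<le> K" for x
    using me[of x] m0[of x] by (simp add: K_def)
  have yK: "\<bar>y b x\<bar> \<le> K" if "b \<in> Basis" for b x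
  proof -
    have "\<bar>x \<bullet> b\<bar> \<le> norm x"
      using that by (rule Basis_le_norm)
    also have "norm x \<le> 1 + x \<bullet> x"
      using sum_squares_bound[of "norm x" 1] norm_ge_zero[of x]
      unfolding power2_norm_eq_inner power_one mult_1_right by linarith
    finally have "\<bar>x \<bullet> b\<bar> * m x \<le> (1 + x \<bullet> x) * m x"
      using m0[of x] by (intro mult_right_mono) auto
    also have "\<dots> \<le> K"
      using xm[of x] me[of x] by (simp add: K_def algebra_simps)
    finally show ?thesis
      using m0[of x] by (simp add: y_def abs_mult)
  qed
  \<comment> \<open>The field \<open>Re (cnj u \<nabla>u) m + c x |u|\<^sup>2 m\<^sup>2\<close>; the value of \<open>c\<close> maximises
      \<open>c d - 4 c - (c - 1)\<^sup>2\<close>, and the maximum is \<open>k\<close>.\<close>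
  define F where "F b x = m x * (u x \<bullet> u1 b x) + (c * y b x * m x) * (u x \<bullet> u x)" for b x
  \<comment> \<open>The derivatives along \<open>b\<close> of the weights are \<open>- 2 y m\<close>
    for \<open>m\<close> and \<open>m - 2 y^2\<close> for \<open>y\<close>; the coefficients below
    result from these and the product rule.\<close>
  define F' where "F' b x = m x * (u1 b x \<bullet> u1 b x) + m x * (u x \<bullet> u2 b x)
    + ((2 * c - 2) * y b x * m x) * (u x \<bullet> u1 b x)
    + (c * m x * m x - 4 * c * y b x * y b x * m x) * (u x \<bullet> u x)" for b x
  have w1: "\<bar>e * y b x * m x\<bar> \<le> \<bar>e\<bar> * K * K" if "b \<in> Basis" for e b x
    using yK[OF that, of x] mK[of x] K by (auto simp: abs_mult intro!: mult_mono)
  have w2: "\<bar>c * m x * m x - 4 * c * y b x * y b x * m x\<bar> \<le> \<bar>c\<bar> * K * K + \<bar>4 * c\<bar> * K * K * K"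
    if "b \<in> Basis" for b x
  proof -
    have "\<bar>c * m x * m x\<bar> \<le> \<bar>c\<bar> * K * K"
      using mK[of x] K by (auto simp: abs_mult intro!: mult_mono)
    moreover have "\<bar>4 * c * y b x * y b x * m x\<bar> \<le> \<bar>4 * c\<bar> * K * K * K"
      unfolding abs_mult using yK[OF that, of x] mK[of x] K by (intro mult_mono) auto
    ultimately show ?thesis by linarith
  qed
  have F_int: "integrable lborel (F b)" if b: "b \<in> Basis" for b
    unfolding F_def
    by (intro Bochner_Integration.integrable_add integrable_weighted_inner[OF _ mK]
        integrable_weighted_inner[OF _ w1[OF b]] u u1[OF b] m_cont y_cont continuous_intros)
  have F'_int: "integrable lborel (F' b)" if b: "b \<in> Basis" for b
    unfolding F'_def
    by (intro Bochner_Integration.integrable_add integrable_weighted_inner[OF _ mK]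
        integrable_weighted_inner[OF _ w1[OF b]] integrable_weighted_inner[OF _ w2[OF b]]
        u u1[OF b] u2[OF b] m_cont y_cont continuous_intros)
  have F'_cont: "continuous_on UNIV (F' b)" if b: "b \<in> Basis" for b
    unfolding F'_def by (intro continuous_intros u u1[OF b] u2[OF b] m_cont y_cont)
  have F_deriv: "((\<lambda>t. F b (x + t *\<^sub>R b)) has_real_derivative F' b x) (at 0)"
    if b: "b \<in> Basis" for b x
  proof -
    note du = du[OF b, of x] and du1 = du1[OF b, of x]
    have inner: "((\<lambda>t. f t \<bullet> g t) has_real_derivative (f 0 \<bullet> g' + f' \<bullet> g 0)) (at 0)"
      if "(f has_vector_derivative f') (at 0)" "(g has_vector_derivative g') (at 0)"
      for f g :: "real \<Rightarrow> complex" and f' g'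
      unfolding has_field_derivative_def
      by (rule has_derivative_eq_rhs[OF has_derivative_inner[OF that[unfolded has_vector_derivative_def]]])
        (simp add: fun_eq_iff algebra_simps)
    have m': "((\<lambda>t. m (x + t *\<^sub>R b)) has_real_derivative - 2 * y b x * m x) (at 0)"
    proof -
      have "((\<lambda>t. (x + t *\<^sub>R b) \<bullet> (x + t *\<^sub>R b) + \<epsilon>) has_real_derivative 2 * (x \<bullet> b)) (at 0)"
        unfolding has_field_derivative_def
        by (auto intro!: derivative_eq_intros simp: inner_commute algebra_simps)
      from DERIV_inverse'[OF this] pos[of x] show ?thesis
        by (simp add: m_def y_def ac_simps)
    qed
    have y': "((\<lambda>t. y b (x + t *\<^sub>R b)) has_real_derivative m x - 2 * y b x * y b x) (at 0)"
    proof -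
      have "((\<lambda>t. (x + t *\<^sub>R b) \<bullet> b) has_real_derivative 1) (at 0)"
        unfolding has_field_derivative_def using b
        by (auto intro!: derivative_eq_intros simp: inner_Basis algebra_simps)
      from DERIV_mult[OF this m'] show ?thesis
        by (simp add: y_def algebra_simps)
    qed
    show ?thesis
      unfolding F_def
      by (rule DERIV_cong[OF DERIV_add[OF DERIV_mult[OF m' inner[OF du du1]]
            DERIV_mult[OF DERIV_mult[OF DERIV_cmult[OF y', of c] m'] inner[OF du du]]]])
        (simp add: F'_def inner_commute algebra_simps)
  qed
  have F'_0: "(LINT x|lborel. F' b x) = 0" if "b \<in> Basis" for b
    using integral_directional_derivative_eq_0[OF F_deriv F'_cont F_int F'_int] that by blast
  define L where "L x = (\<Sum>b\<in>Basis. u2 b x)" for x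
  have pointwise: "k / 2 * (m x * m x * (u x \<bullet> u x)) - (L x \<bullet> L x) / (2 * k) \<le> (\<Sum>b\<in>Basis. F' b x)" for x
  proof -
    let ?U = "u x \<bullet> u x"
    have "m x * (u x \<bullet> u2 b x) + c * (m x * m x * ?U) - ((c - 1)\<^sup>2 + 4 * c) * m x ^ 3 * ?U * (x \<bullet> b)\<^sup>2 \<le> F' b x"
      if "b \<in> Basis" for b
    proof -
      \<comment> \<open>The multiple \<open>c - 1\<close> is chosen so that the cross term of
        \<open>m (?v \<bullet> ?v)\<close> equals the first-order term of \<open>F'\<close>. What
        the square adds is \<open>(c - 1)^2\<close> in front of \<open>y^2 m |u|^2\<close>, on top
        of the \<open>4 c\<close> coming from the weights.\<close>
      let ?v = "u1 b x + ((c - 1) * y b x) *\<^sub>R u x"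
      have "0 \<le> m x * (?v \<bullet> ?v)"
        using m0[of x] by simp
      also have "\<dots> = F' b x - (m x * (u x \<bullet> u2 b x) + c * (m x * m x * ?U) - ((c - 1)\<^sup>2 + 4 * c) * m x ^ 3 * ?U * (x \<bullet> b)\<^sup>2)"
        by (simp add: F'_def y_def inner_add_left inner_add_right inner_commute power2_eq_square power3_eq_cube algebra_simps)
      finally show ?thesis by simp
    qed
    then have "(\<Sum>b\<in>Basis. m x * (u x \<bullet> u2 b x) + c * (m x * m x * ?U) - ((c - 1)\<^sup>2 + 4 * c) * m x ^ 3 * ?U * (x \<bullet> b)\<^sup>2)
        \<le> (\<Sum>b\<in>Basis. F' b x)"
      by (rule sum_mono)
    also have "(\<Sum>b\<in>Basis. m x * (u x \<bullet> u2 b x) + c * (m x * m x * ?U) - ((c - 1)\<^sup>2 + 4 * c) * m x ^ 3 * ?U * (x \<bullet> b)\<^sup>2)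
        = m x * (u x \<bullet> L x) + d * c * (m x * m x * ?U) - ((c - 1)\<^sup>2 + 4 * c) * m x ^ 3 * ?U * (x \<bullet> x)"
      by (simp add: sum_subtractf sum.distrib L_def inner_sum_right d_def sum_distrib_left[symmetric]
          euclidean_inner[of x x] power2_eq_square)
    finally have 1: "m x * (u x \<bullet> L x) + d * c * (m x * m x * ?U) - ((c - 1)\<^sup>2 + 4 * c) * m x ^ 3 * ?U * (x \<bullet> x)
        \<le> (\<Sum>b\<in>Basis. F' b x)" .
    \<comment> \<open>The only loss caused by the regularisation. The term on the left is subtracted
      in the lower bound and its coefficient is nonnegative, so enlarging it by
      \<open>r^2 m \<le> 1\<close> is legitimate, and the remaining coefficient is exactly
      \<open>k\<close>.\<close>
    have "((c - 1)\<^sup>2 + 4 * c) * (m x * m x * ?U) * ((x \<bullet> x) * m x) \<le> ((c - 1)\<^sup>2 + 4 * c) * (m x * m x * ?U) * 1"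
      using d m0[of x] by (intro mult_left_mono xm mult_nonneg_nonneg add_nonneg_nonneg) (auto simp: c_def)
    then have 2: "((c - 1)\<^sup>2 + 4 * c) * m x ^ 3 * ?U * (x \<bullet> x) \<le> ((c - 1)\<^sup>2 + 4 * c) * (m x * m x * ?U)"
      by (simp add: power3_eq_cube ac_simps)
    have 3: "d * c - ((c - 1)\<^sup>2 + 4 * c) = k"
      by (simp add: c_def k_def power2_eq_square field_simps)
    have "k * (m x * m x * ?U) = d * c * (m x * m x * ?U) - ((c - 1)\<^sup>2 + 4 * c) * (m x * m x * ?U)"
      by (simp only: 3[symmetric] left_diff_distrib)
    then have 4: "m x * (u x \<bullet> L x) + k * (m x * m x * ?U) \<le> (\<Sum>b\<in>Basis. F' b x)"
      using 1 2 by linarith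
    \<comment> \<open>The scaling is such that the mixed term \<open>m (u \<bullet> L)\<close>
      appears with coefficient 1 and uses up half of \<open>k m^2 |u|^2\<close>. Multiplying the
      integrated inequality by \<open>2 k\<close> then gives the factor \<open>k^2\<close>.\<close>
    have "0 \<le> (L x + (k * m x) *\<^sub>R u x) \<bullet> (L x + (k * m x) *\<^sub>R u x) / (2 * k)"
      using k by simp
    also have "\<dots> = (L x \<bullet> L x) / (2 * k) + m x * (u x \<bullet> L x) + k / 2 * (m x * m x * ?U)"
      using k by (simp add: inner_add_left inner_add_right inner_commute field_simps)
    finally show ?thesis using 4 by linarith
  qed
  have L_int: "integrable lborel (\<lambda>x. L x \<bullet> L x)"
  proof -
    have "integrable lborel (\<lambda>x. \<Sum>b\<in>Basis. \<Sum>b'\<in>Basis. 1 * (u2 b' x \<bullet> u2 b x))"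
      by (intro Bochner_Integration.integrable_sum integrable_weighted_inner[where K=1] u2) auto
    then show ?thesis
      by (simp add: L_def inner_sum_left inner_sum_right)
  qed
  have mu_int: "integrable lborel (\<lambda>x. (m x * m x) * (u x \<bullet> u x))"
    by (intro integrable_weighted_inner[where K="K * K"] u continuous_intros m_cont)
      (use mK K in \<open>auto simp: abs_mult simp del: abs_mult_self_eq intro!: mult_mono\<close>)
  have "(LINT x|lborel. k / 2 * (m x * m x * (u x \<bullet> u x)) - (L x \<bullet> L x) / (2 * k)) \<le> (LINT x|lborel. (\<Sum>b\<in>Basis. F' b x))"
    using L_int mu_int F'_int pointwise
    by (intro integral_mono Bochner_Integration.integrable_diff Bochner_Integration.integrable_sum
        integrable_mult_right integrable_divide) auto
  also have "\<dots> = 0"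
    using F'_int F'_0 by (subst Bochner_Integration.integral_sum) auto
  finally have "k / 2 * (LINT x|lborel. m x * m x * (u x \<bullet> u x)) - (LINT x|lborel. L x \<bullet> L x) / (2 * k) \<le> 0"
    using L_int mu_int by (subst (asm) Bochner_Integration.integral_diff) auto
  then have "k\<^sup>2 * (LINT x|lborel. m x * m x * (u x \<bullet> u x)) \<le> (LINT x|lborel. L x \<bullet> L x)"
    using k by (simp add: field_simps power2_eq_square)
  moreover have "rellich_constant DIM('a) = k\<^sup>2"
    by (simp add: rellich_constant_def k_def d_def power_mult_distrib power_divide)
  moreover have "(cmod (u x))\<^sup>2 / (x \<bullet> x + \<epsilon>)\<^sup>2 = m x * m x * (u x \<bullet> u x)" for x
    unfolding m_def power2_norm_eq_inner by (simp add: divide_inverse power2_eq_square)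
  ultimately show ?thesis
    by (simp add: L_def power2_norm_eq_inner)
qed

section \<open>Mollifiers\<close>

lemma sigma_finite_lebesgue: "sigma_finite_measure (lebesgue :: 'a::euclidean_space measure)"
proof (intro sigma_finite_measure.intro exI conjI ballI)
  show "countable (range (\<lambda>n::nat. cball (0::'a) (real n)))" by simp
  have "\<exists>n::nat. norm x \<le> real n" for x :: 'a
    by (rule real_arch_simple)
  then show "\<Union> (range (\<lambda>n::nat. cball (0::'a) (real n))) = space lebesgue"
    by auto
  show "emeasure lebesgue A \<noteq> \<infinity>" if "A \<in> range (\<lambda>n::nat. cball (0::'a) (real n))" for A
    using that fmeasurableD2[OF lmeasurable_cball, of "0::'a"] by auto
qed auto

definition mollifier :: "real \<Rightarrow> ('a::euclidean_space \<Rightarrow> real) \<Rightarrow> bool" where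
  "mollifier s r \<longleftrightarrow> (\<lambda>x. complex_of_real (r x)) \<in> test_functions \<and> (\<forall>x. 0 \<le> r x) \<and>
    (\<forall>x. norm x \<ge> s \<longrightarrow> r x = 0) \<and> integrable lborel r \<and> (LINT x|lborel. r x) = 1"

lemma integrable_continuous_bounded_support:
  fixes f :: "'a::euclidean_space \<Rightarrow> 'b::euclidean_space"
  assumes "continuous_on UNIV f" "\<And>x. norm x > R \<Longrightarrow> f x = 0"
  shows "integrable lborel f"
proof -
  have "integrable lborel (\<lambda>x. indicator (cball 0 R) x *\<^sub>R f x)"
    by (rule borel_integrable_compact) (auto intro: continuous_on_subset[OF assms(1)])
  moreover have "indicator (cball 0 R) x *\<^sub>R f x = f x" for x
    using assms(2)[of x] by (cases "norm x \<le> R") auto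
  ultimately show ?thesis by (simp only:)
qed

lemma mollifier_exists:
  assumes s: "s > 0"
  obtains r :: "'a::euclidean_space \<Rightarrow> real" where "mollifier s r"
proof -
  define \<phi> where "\<phi> x = flat 0 (s\<^sup>2 - x \<bullet> x)" for x :: 'a
  have \<phi>0: "\<phi> x = 0" if "norm x \<ge> s" for x
  proof -
    have "s\<^sup>2 \<le> x \<bullet> x"
      using that s by (simp add: power2_norm_eq_inner[symmetric])
    then show ?thesis by (simp add: \<phi>_def flat_def)
  qed
  have \<phi>pos: "\<phi> x > 0" if "norm x < s" for x
  proof -
    have "x \<bullet> x < s\<^sup>2"
      using that s by (simp add: power2_norm_eq_inner[symmetric] power_strict_mono)
    then show ?thesis by (simp add: \<phi>_def flat_pos)
  qed
  have \<phi>nn: "\<phi> x \<ge> 0" for x by (simp add: \<phi>_def flat_nonneg)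
  have \<phi>cont: "continuous_on UNIV \<phi>"
    unfolding \<phi>_def
    by (rule continuous_on_compose2[where f="\<lambda>x. s\<^sup>2 - x \<bullet> x" and t=UNIV])
      (auto intro!: continuous_intros DERIV_continuous_on flat_has_real_derivative)
  have int: "integrable lborel \<phi>"
    by (rule integrable_continuous_bounded_support[where R=s, OF \<phi>cont \<phi>0]) simp
  define I where "I = (LINT x|lborel. \<phi> x)"
  have "I \<noteq> 0"
  proof
    assume "I = 0"
    then have "AE x in lborel. \<phi> x = 0"
      using integral_nonneg_eq_0_iff_AE[OF int] \<phi>nn by (simp add: I_def)
    then have "AE x in lborel. x \<notin> ball (0::'a) s"
    proof eventually_elim
      case (elim x)
      then show ?case using \<phi>pos[of x] by auto
    qed
    then have "AE x in lebesgue. x \<notin> ball (0::'a) s"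
      by (rule AE_completion)
    then have "negligible (ball (0::'a) s)"
      using AE_iff_null_sets[of "ball (0::'a) s" lebesgue] by (simp add: negligible_iff_null_sets)
    then show False
      using open_not_negligible[of "ball (0::'a) s"] s by auto
  qed
  moreover have "I \<ge> 0"
    unfolding I_def using \<phi>nn by (intro integral_nonneg_AE) auto
  ultimately have I: "I > 0" by simp
  have test: "(\<lambda>x. complex_of_real ((1 / I) * \<phi> x)) \<in> test_functions"
    unfolding \<phi>_def
    using s by (intro bumps_test_functions[where R=s] bumps.poly real_polynomial_function.intros(2)) auto
  have "(LINT x|lborel. (1 / I) * \<phi> x) = 1"
    using I by (simp flip: I_def)
  then have "mollifier s (\<lambda>x. (1 / I) * \<phi> x)"
    unfolding mollifier_def using I \<phi>nn \<phi>0 int test by simp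
  then show thesis by (rule that)
qed

lemma lborel_reflect:
  fixes c :: "'a::euclidean_space"
  shows "distr lborel borel (\<lambda>y. c - y) = lborel"
proof -
  have "lborel = density (distr lborel borel (\<lambda>y. c + (- 1) *\<^sub>R y)) (\<lambda>_. ennreal (\<bar>- 1\<bar> ^ DIM('a)))"
    by (rule lborel_affine) simp
  then show ?thesis
    by (simp add: density_1)
qed

lemma mollifier_continuous:
  assumes "mollifier s r"
  shows "continuous_on UNIV r"
proof -
  have "continuous_on UNIV (\<lambda>x. Re (complex_of_real (r x)))"
    using assms by (intro continuous_intros test_functions_continuous) (auto simp: mollifier_def)
  then show ?thesis by simp
qed

lemma mollifier_reflect:
  assumes "mollifier s r"
  shows "integrable lebesgue (\<lambda>y. r (x - y))" "(LINT y|lebesgue. r (x - y)) = 1"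
proof -
  have [measurable]: "r \<in> borel_measurable borel"
    using mollifier_continuous[OF assms] by (rule borel_measurable_continuous_onI)
  have r: "integrable lborel r" "(LINT y|lborel. r y) = 1"
    using assms by (auto simp: mollifier_def)
  have "integrable (distr lborel borel (\<lambda>y. x - y)) r \<longleftrightarrow> integrable lborel (\<lambda>y. r (x - y))"
    by (intro integrable_distr_eq) auto
  then show "integrable lebesgue (\<lambda>y. r (x - y))"
    using r by (subst integrable_completion) (auto simp: lborel_reflect)
  have "(LINT y|distr lborel borel (\<lambda>y. x - y). r y) = (LINT y|lborel. r (x - y))"
    by (intro integral_distr) auto
  then show "(LINT y|lebesgue. r (x - y)) = 1"
    using r by (subst integral_completion) (auto simp: lborel_reflect)
qed

lemma mollifier_translate:
  assumes "mollifier s r"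
  shows "integrable lborel (\<lambda>x. r (x - y))" "(LINT x|lborel. r (x - y)) = 1"
    "(\<integral>\<^sup>+x. ennreal (r (x - y)) \<partial>lborel) = 1"
proof -
  have [measurable]: "r \<in> borel_measurable borel"
    using mollifier_continuous[OF assms] by (rule borel_measurable_continuous_onI)
  show 1: "integrable lborel (\<lambda>x. r (x - y))" and 2: "(LINT x|lborel. r (x - y)) = 1"
    using assms lborel_translate[of r "- y"] by (auto simp: mollifier_def)
  show "(\<integral>\<^sup>+x. ennreal (r (x - y)) \<partial>lborel) = 1"
    using assms by (subst nn_integral_eq_integral[OF 1]) (auto simp: 2 mollifier_def)
qed

lemma mollifier_bounded:
  assumes "mollifier s r"
  obtains M where "M > 0" "\<And>x. r x \<le> M"
proof -
  obtain M where "M > 0" "\<And>x. norm (complex_of_real (r x)) \<le> M"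
    using assms test_functions_bounded unfolding mollifier_def by blast
  then have "r x \<le> M" for x
    using abs_le_D1 by (metis norm_of_real)
  with \<open>M > 0\<close> show thesis by (rule that)
qed

text \<open>With \<open>w\<close> as a probability density, the variance of \<open>|g|\<close> is
  nonnegative, so the square of its mean \<open>\<mu>\<close> is at most the mean of its square; and
  \<open>\<mu>\<close> dominates the modulus of the convolution.\<close>

lemma conv_mollifier_Jensen:
  assumes r: "mollifier s r" and g: "locally_integrable g" "g \<in> L2"
  shows "ennreal ((cmod (conv g (\<lambda>x. of_real (r x)) x))\<^sup>2)
    \<le> (\<integral>\<^sup>+y. ennreal ((cmod (g y))\<^sup>2 * r (x - y)) \<partial>lebesgue)"
proof -
  define h where "h y = cmod (g y)" for y
  define w where "w y = r (x - y)" for y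
  obtain M where M: "M > 0" "\<And>x. r x \<le> M"
    using mollifier_bounded[OF r] by blast
  have w0: "w y \<ge> 0" for y using r by (simp add: w_def mollifier_def)
  have w1: "integrable lebesgue w" "(LINT y|lebesgue. w y) = 1"
    using mollifier_reflect[OF r, of x] by (auto simp: w_def[abs_def])
  have test: "(\<lambda>x. complex_of_real (r x)) \<in> test_functions"
    using r by (simp add: mollifier_def)
  have gw: "integrable lebesgue (\<lambda>y. g y * of_real (w y))"
    using conv_integrable[OF g(1) test] by (simp add: w_def)
  have [measurable]: "h \<in> borel_measurable lebesgue" "w \<in> borel_measurable lebesgue"
    using locally_integrable_measurable[OF g(1)] w1(1) by (auto simp: h_def[abs_def])
  have hw: "integrable lebesgue (\<lambda>y. h y * w y)"
    using integrable_norm[OF gw] w0 by (simp add: norm_mult h_def)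
  have h2w: "integrable lebesgue (\<lambda>y. (h y)\<^sup>2 * w y)"
  proof (rule Bochner_Integration.integrable_bound)
    show "integrable lebesgue (\<lambda>y. (h y)\<^sup>2 * M)"
      using g(2) by (simp add: L2_def h_def)
    show "AE y in lebesgue. norm ((h y)\<^sup>2 * w y) \<le> norm ((h y)\<^sup>2 * M)"
      using M w0 by (intro AE_I2) (auto simp: abs_mult w_def intro!: mult_left_mono)
  qed measurable
  define \<mu> where "\<mu> = (LINT y|lebesgue. h y * w y)"
  have "0 \<le> (LINT y|lebesgue. (h y - \<mu>)\<^sup>2 * w y)"
    using w0 by (intro integral_nonneg_AE) auto
  also have "\<dots> = (LINT y|lebesgue. ((h y)\<^sup>2 * w y - (2 * \<mu>) * (h y * w y)) + \<mu>\<^sup>2 * w y)"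
    by (intro Bochner_Integration.integral_cong refl) (simp add: power2_eq_square algebra_simps)
  also have "\<dots> = (LINT y|lebesgue. (h y)\<^sup>2 * w y) - \<mu>\<^sup>2"
    using hw h2w w1 by (simp add: \<mu>_def[symmetric] power2_eq_square)
  finally have "\<mu>\<^sup>2 \<le> (LINT y|lebesgue. (h y)\<^sup>2 * w y)" by simp
  moreover have "cmod (conv g (\<lambda>x. of_real (r x)) x) \<le> \<mu>"
    using integral_norm_bound[of lebesgue "\<lambda>y. g y * of_real (w y)"] w0
    by (simp add: conv_def w_def \<mu>_def h_def norm_mult)
  then have "(cmod (conv g (\<lambda>x. of_real (r x)) x))\<^sup>2 \<le> \<mu>\<^sup>2"
    by (intro power_mono) auto
  ultimately have "ennreal ((cmod (conv g (\<lambda>x. of_real (r x)) x))\<^sup>2) \<le> ennreal (LINT y|lebesgue. (h y)\<^sup>2 * w y)"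
    by (intro ennreal_leI) linarith
  also have "\<dots> = (\<integral>\<^sup>+y. ennreal ((h y)\<^sup>2 * w y) \<partial>lebesgue)"
    using w0 by (intro nn_integral_eq_integral[OF h2w, symmetric]) auto
  finally show ?thesis
    by (simp add: h_def w_def)
qed

text \<open>The two factors differ on purpose. Elements of \<open>L2\<close> are only Lebesgue
  measurable, so the variable of the given function carries \<open>lebesgue\<close>; a convolution
  is continuous, so its variable can carry \<open>lborel\<close>. Fubini is applied on this mixed
  product.\<close>

lemma measurable_diff_lborel_lebesgue:
  "(\<lambda>(x, y). x - y) \<in> borel_measurable ((lborel :: 'a measure) \<Otimes>\<^sub>M (lebesgue :: 'a::euclidean_space measure))"
proof -
  have "(\<lambda>x. x) \<in> borel_measurable (lebesgue :: 'a measure)"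
    by (intro measurable_completion) simp
  then have [measurable]: "snd \<in> borel_measurable ((lborel :: 'a measure) \<Otimes>\<^sub>M (lebesgue :: 'a measure))"
    by (rule measurable_compose[OF measurable_snd])
  have "(\<lambda>x. x) \<in> borel_measurable (lborel :: 'a measure)" by simp
  then have [measurable]: "fst \<in> borel_measurable ((lborel :: 'a measure) \<Otimes>\<^sub>M (lebesgue :: 'a measure))"
    by (rule measurable_compose[OF measurable_fst])
  show ?thesis
    unfolding case_prod_beta by measurable
qed

text \<open>The pointwise Jensen bound is integrated in \<open>x\<close> and the order exchanged by
  Tonelli; the inner integral of \<open>r (x - y)\<close> over \<open>x\<close> is 1, so
  mollification does not increase the \<open>L2\<close> norm.\<close>

lemma conv_mollifier_L2:
  fixes g :: "'a::euclidean_space \<Rightarrow> complex"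
  assumes r: "mollifier s r" and g: "locally_integrable g" "g \<in> L2"
  shows "integrable lborel (\<lambda>x. (cmod (conv g (\<lambda>x. of_real (r x)) x))\<^sup>2)" (is "integrable _ ?C")
    and "(LINT x|lborel. (cmod (conv g (\<lambda>x. of_real (r x)) x))\<^sup>2) \<le> (LINT x|lebesgue. (cmod (g x))\<^sup>2)"
proof -
  interpret sigma_finite_measure "lebesgue :: 'a measure" by (rule sigma_finite_lebesgue)
  interpret pair_sigma_finite "lborel :: 'a measure" "lebesgue :: 'a measure" ..
  note [measurable] = measurable_diff_lborel_lebesgue locally_integrable_measurable[OF g(1)]
  have rm[measurable]: "r \<in> borel_measurable borel"
    using mollifier_continuous[OF r] by (rule borel_measurable_continuous_onI)
  have m1: "(\<lambda>p. r (fst p - snd p)) \<in> borel_measurable ((lborel :: 'a measure) \<Otimes>\<^sub>M (lebesgue :: 'a measure))"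
    using measurable_compose[OF measurable_diff_lborel_lebesgue rm] by (simp add: case_prod_beta)
  have m2: "(\<lambda>p. cmod (g (snd p))) \<in> borel_measurable ((lborel :: 'a measure) \<Otimes>\<^sub>M (lebesgue :: 'a measure))"
    by measurable
  have meas: "(\<lambda>p. ennreal ((cmod (g (snd p)))\<^sup>2 * r (fst p - snd p))) \<in> borel_measurable ((lborel :: 'a measure) \<Otimes>\<^sub>M (lebesgue :: 'a measure))"
    using m1 m2 by measurable
  have g2: "integrable lebesgue (\<lambda>y. (cmod (g y))\<^sup>2)"
    using g(2) by (simp add: L2_def)
  have "(\<integral>\<^sup>+x. ennreal (?C x) \<partial>lborel)
      \<le> (\<integral>\<^sup>+x. (\<integral>\<^sup>+y. ennreal ((cmod (g y))\<^sup>2 * r (x - y)) \<partial>lebesgue) \<partial>lborel)"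
    by (intro nn_integral_mono conv_mollifier_Jensen[OF r g])
  also have "\<dots> = (\<integral>\<^sup>+y. (\<integral>\<^sup>+x. ennreal ((cmod (g y))\<^sup>2 * r (x - y)) \<partial>lborel) \<partial>lebesgue)"
    using Fubini[OF meas] by simp
  also have "\<dots> = (\<integral>\<^sup>+y. ennreal ((cmod (g y))\<^sup>2) \<partial>lebesgue)"
  proof (intro nn_integral_cong)
    fix y
    have "(\<integral>\<^sup>+x. ennreal ((cmod (g y))\<^sup>2 * r (x - y)) \<partial>lborel) =
        (\<integral>\<^sup>+x. ennreal ((cmod (g y))\<^sup>2) * ennreal (r (x - y)) \<partial>lborel)"
      using r by (intro nn_integral_cong ennreal_mult) (auto simp: mollifier_def)
    also have "\<dots> = ennreal ((cmod (g y))\<^sup>2)"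
      using mollifier_translate(3)[OF r, of y] by (subst nn_integral_cmult) auto
    finally show "(\<integral>\<^sup>+x. ennreal ((cmod (g y))\<^sup>2 * r (x - y)) \<partial>lborel) = ennreal ((cmod (g y))\<^sup>2)" .
  qed
  also have "\<dots> = ennreal (LINT x|lebesgue. (cmod (g x))\<^sup>2)"
    by (intro nn_integral_eq_integral[OF g2]) auto
  finally have le: "(\<integral>\<^sup>+x. ennreal (?C x) \<partial>lborel) \<le> ennreal (LINT x|lebesgue. (cmod (g x))\<^sup>2)" .
  have test: "(\<lambda>x. complex_of_real (r x)) \<in> test_functions"
    using r by (simp add: mollifier_def)
  have "?C \<in> borel_measurable borel"
    by (intro borel_measurable_continuous_onI continuous_intros conv_continuous[OF g(1) test])
  then show int: "integrable lborel ?C"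
    using le by (intro integrableI_bounded) (auto intro: le_less_trans)
  have "ennreal (LINT x|lborel. ?C x) \<le> ennreal (LINT x|lebesgue. (cmod (g x))\<^sup>2)"
    using le by (subst (asm) nn_integral_eq_integral[OF int]) auto
  then show "(LINT x|lborel. ?C x) \<le> (LINT x|lebesgue. (cmod (g x))\<^sup>2)"
    by (subst (asm) ennreal_le_iff) (auto intro: integral_nonneg_AE)
qed

lemma norm_lebesgue_integral_le:
  fixes f :: "'a \<Rightarrow> 'b::{banach, second_countable_topology}"
  assumes "integrable M f" "integrable M g" "\<And>x. norm (f x) \<le> g x"
  shows "norm (LINT x|M. f x) \<le> (LINT x|M. g x)"
proof -
  have "norm (LINT x|M. f x) \<le> (LINT x|M. norm (f x))"
    by (rule integral_norm_bound)
  also have "\<dots> \<le> (LINT x|M. g x)"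
    using assms by (intro integral_mono integrable_norm) auto
  finally show ?thesis .
qed

text \<open>Fubini moves the mollifier from \<open>u\<close> onto \<open>\<psi>\<close>. The
  averages of the continuous function \<open>\<psi>\<close> converge to it at every point, are
  bounded by the same constant and vanish outside the ball of radius \<open>R + 1\<close>, so local
  integrability of \<open>u\<close> is enough for the limit.\<close>

lemma conv_weak_limit:
  fixes u \<psi> :: "'a::euclidean_space \<Rightarrow> complex"
  assumes u: "locally_integrable u" and \<psi>: "continuous_on UNIV \<psi>"
    and R: "\<And>x. norm x > R \<Longrightarrow> \<psi> x = 0"
    and r: "\<And>n. mollifier (1 / Suc n) (r n)"
  shows "(\<lambda>n. LINT x|lborel. conv u (\<lambda>x. of_real (r n x)) x * \<psi> x) \<longlonglongrightarrow> (LINT x|lebesgue. u x * \<psi> x)"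
proof -
  interpret sigma_finite_measure "lebesgue :: 'a measure" by (rule sigma_finite_lebesgue)
  interpret pair_sigma_finite "lborel :: 'a measure" "lebesgue :: 'a measure" ..
  have "bounded (\<psi> ` cball 0 R)"
    by (intro compact_imp_bounded compact_continuous_image continuous_on_subset[OF \<psi>]) auto
  then obtain C where C: "C > 0" "\<And>x. x \<in> cball 0 R \<Longrightarrow> norm (\<psi> x) \<le> C"
    by (auto simp: bounded_pos)
  have C': "norm (\<psi> x) \<le> C" for x
    using C R[of x] by (cases "norm x > R") auto
  have rm[measurable]: "r n \<in> borel_measurable borel" for n
    using mollifier_continuous[OF r] by (rule borel_measurable_continuous_onI)
  have [measurable]: "\<psi> \<in> borel_measurable borel"
    using \<psi> by (rule borel_measurable_continuous_onI)
  note [measurable] = locally_integrable_measurable[OF u]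
  have r0: "r n x \<ge> 0" for n x using r[of n] by (simp add: mollifier_def)
  have rs: "r n x = 0" if "norm x \<ge> 1 / Suc n" for n x using r[of n] that by (simp add: mollifier_def)
  note rt = mollifier_translate[OF r]
  \<comment> \<open>Smoothing with the reflected mollifier, the transpose of convolution with
    \<open>r n\<close>. It takes an arbitrary \<open>f\<close> because it is applied both to
    \<open>\<psi>\<close> and to \<open>|\<psi>|\<close>; the latter computes the iterated integral
    of norms that justifies Fubini.\<close>
  define P where "P f n y = (LINT x|lborel. r n (x - y) *\<^sub>R f x)" for f :: "'a \<Rightarrow> complex" and n y
  have int: "integrable lborel (\<lambda>x. r n (x - y) *\<^sub>R f x)"
    if [measurable]: "f \<in> borel_measurable borel" and "\<And>x. norm (f x) \<le> C" for f :: "'a \<Rightarrow> complex" and n y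
  proof (rule Bochner_Integration.integrable_bound)
    show "integrable lborel (\<lambda>x. r n (x - y) * C)" using rt(1) by simp
    show "AE x in lborel. norm (r n (x - y) *\<^sub>R f x) \<le> norm (r n (x - y) * C)"
      using that(2) r0 C by (intro AE_I2) (auto simp: abs_mult intro!: mult_left_mono)
  qed measurable
  have P_meas: "P f n \<in> borel_measurable lebesgue" if [measurable]: "f \<in> borel_measurable borel" for f n
    unfolding P_def by (intro measurable_completion) measurable
  have P_bound: "norm (P f n y) \<le> C" if "f \<in> borel_measurable borel" "\<And>x. norm (f x) \<le> C" for f n y
  proof -
    have "norm (P f n y) \<le> (LINT x|lborel. r n (x - y) * C)"
      unfolding P_def
      by (intro norm_lebesgue_integral_le int[OF that] integrable_mult_left rt(1))
        (use that r0 in \<open>auto simp: intro!: mult_left_mono\<close>)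
    then show ?thesis using rt(2) by simp
  qed
  have P_supp: "P f n y = 0" if "\<And>x. norm x > R \<Longrightarrow> f x = 0" "norm y > R + 1" for f n y
  proof -
    have "r n (x - y) *\<^sub>R f x = 0" for x
    proof (cases "norm x > R")
      case False
      have "1 / real (Suc n) \<le> 1" by simp
      also have "1 \<le> norm (x - y)"
        using False that(2) norm_triangle_ineq2[of y x] by (simp add: norm_minus_commute)
      finally show ?thesis by (simp add: rs)
    qed (simp add: that)
    then show ?thesis
      unfolding P_def by (simp only: Bochner_Integration.integral_zero)
  qed
  have lim: "(\<lambda>n. P \<psi> n y) \<longlonglongrightarrow> \<psi> y" for y
  proof (rule metric_LIMSEQ_I)
    fix e :: real assume e: "e > 0"
    then obtain t where t: "t > 0" "\<And>x. dist x y < t \<Longrightarrow> dist (\<psi> x) (\<psi> y) < e / 2"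
      using \<psi> half_gt_zero[OF e] unfolding continuous_on_iff by (metis UNIV_I)
    obtain N where N: "1 / real (Suc N) < t"
      using t(1) nat_approx_posE by blast
    have "dist (P \<psi> n y) (\<psi> y) < e" if "n \<ge> N" for n
    proof -
      have "P \<psi> n y - \<psi> y = P \<psi> n y - (LINT x|lborel. r n (x - y) *\<^sub>R \<psi> y)"
        using rt by simp
      also have "\<dots> = (LINT x|lborel. r n (x - y) *\<^sub>R (\<psi> x - \<psi> y))"
        unfolding P_def using int[OF _ C'] rt(1)
        by (subst Bochner_Integration.integral_diff[symmetric]) (auto simp: scaleR_right_diff_distrib)
      also have "norm \<dots> \<le> (LINT x|lborel. r n (x - y) * (e / 2))"
      proof (intro norm_lebesgue_integral_le integrable_mult_left rt(1))
        show "integrable lborel (\<lambda>x. r n (x - y) *\<^sub>R (\<psi> x - \<psi> y))"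
          using int[OF _ C'] rt(1) by (simp add: scaleR_right_diff_distrib)
        fix x
        show "norm (r n (x - y) *\<^sub>R (\<psi> x - \<psi> y)) \<le> r n (x - y) * (e / 2)"
        proof (cases "norm (x - y) < 1 / Suc n")
          case True
          also have "1 / real (Suc n) \<le> 1 / real (Suc N)"
            using \<open>n \<ge> N\<close> by (simp add: frac_le)
          finally have "dist x y < t" using N by (simp add: dist_norm)
          then have "norm (\<psi> x - \<psi> y) \<le> e / 2"
            using t(2) by (simp add: dist_norm less_imp_le)
          then show ?thesis using r0 by (simp add: mult_left_mono del: times_divide_eq_right)
        qed (simp add: rs)
      qed
      also have "\<dots> = e / 2" using rt(2) by simp
      finally show ?thesis using e by (simp add: dist_norm)
    qed
    then show "\<exists>N. \<forall>n\<ge>N. dist (P \<psi> n y) (\<psi> y) < e" by blast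
  qed
  have "(\<lambda>n. LINT y|lebesgue. u y * P \<psi> n y) \<longlonglongrightarrow> (LINT y|lebesgue. u y * \<psi> y)"
    by (rule tendsto_integral_mult_bounded_support[OF u P_meas _ _ P_bound P_supp])
      (use R C' lim \<psi> measurable_lebesgue_continuous in auto)
  moreover have "(LINT y|lebesgue. u y * P \<psi> n y) = (LINT x|lborel. conv u (\<lambda>x. of_real (r n x)) x * \<psi> x)" for n
  proof -
    define F where "F x y = u y * (r n (x - y) *\<^sub>R \<psi> x)" for x y
    have m1: "(\<lambda>p. r n (fst p - snd p)) \<in> borel_measurable ((lborel :: 'a measure) \<Otimes>\<^sub>M (lebesgue :: 'a measure))"
      using measurable_compose[OF measurable_diff_lborel_lebesgue rm] by (simp add: case_prod_beta)
    have m2: "(\<lambda>p. u (snd p)) \<in> borel_measurable ((lborel :: 'a measure) \<Otimes>\<^sub>M (lebesgue :: 'a measure))"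
      "(\<lambda>p. \<psi> (fst p)) \<in> borel_measurable ((lborel :: 'a measure) \<Otimes>\<^sub>M (lebesgue :: 'a measure))"
      by measurable
    have F_meas: "(\<lambda>(x, y). F x y) \<in> borel_measurable ((lborel :: 'a measure) \<Otimes>\<^sub>M (lebesgue :: 'a measure))"
      unfolding F_def case_prod_beta using m1 m2 by measurable
    interpret swap: pair_sigma_finite "lebesgue :: 'a measure" "lborel :: 'a measure" ..
    have "integrable (lebesgue \<Otimes>\<^sub>M lborel) (\<lambda>(y, x). F x y)"
    proof (rule swap.Fubini_integrable)
      show "(\<lambda>(y, x). F x y) \<in> borel_measurable (lebesgue \<Otimes>\<^sub>M lborel)"
        using measurable_compose[OF measurable_pair_swap' F_meas] by (simp add: case_prod_beta)
      have "integrable lebesgue (\<lambda>y. norm (u y * P (\<lambda>x. of_real (norm (\<psi> x))) n y))"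
        by (intro integrable_norm locally_integrable_integrable_mult[OF u, where M=C and R="R + 1"]
            P_meas P_bound P_supp) (use R C' in auto)
      moreover have "norm (u y * P (\<lambda>x. of_real (norm (\<psi> x))) n y) =
          (LINT x|lborel. norm (case (y, x) of (y, x) \<Rightarrow> F x y))" for y
      proof -
        have "P (\<lambda>x. of_real (norm (\<psi> x))) n y = of_real (LINT x|lborel. r n (x - y) * norm (\<psi> x))"
          unfolding P_def by (subst integral_complex_of_real[symmetric]) (simp add: scaleR_conv_of_real)
        moreover have "(LINT x|lborel. r n (x - y) * norm (\<psi> x)) \<ge> 0"
          using r0 by (intro integral_nonneg_AE) auto
        moreover have "norm (F x y) = norm (u y) * (r n (x - y) * norm (\<psi> x))" for x
          using r0 by (simp add: F_def norm_mult)
        ultimately show ?thesis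
          by (simp add: norm_mult)
      qed
      ultimately show "integrable lebesgue (\<lambda>y. LINT x|lborel. norm (case (y, x) of (y, x) \<Rightarrow> F x y))"
        by simp
      show "AE y in lebesgue. integrable lborel (\<lambda>x. case (y, x) of (y, x) \<Rightarrow> F x y)"
      proof (rule AE_I2)
        fix y
        have "integrable lborel (\<lambda>x. u y * (r n (x - y) *\<^sub>R \<psi> x))"
          by (intro integrable_mult_right int C') simp
        then show "integrable lborel (\<lambda>x. case (y, x) of (y, x) \<Rightarrow> F x y)"
          by (simp only: F_def prod.case)
      qed
    qed
    then have "(LINT x|lborel. (LINT y|lebesgue. F x y)) = (LINT y|lebesgue. (LINT x|lborel. F x y))"
      by (rule swap.Fubini_integral)
    moreover have "(LINT y|lebesgue. F x y) = conv u (\<lambda>x. of_real (r n x)) x * \<psi> x" for x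
    proof -
      have "F x y = (u y * of_real (r n (x - y))) * \<psi> x" for y
        by (simp add: F_def scaleR_conv_of_real)
      then show ?thesis by (simp add: conv_def)
    qed
    moreover have "(LINT x|lborel. F x y) = u y * P \<psi> n y" for y
      unfolding F_def P_def by (rule integral_mult_right_zero)
    ultimately show ?thesis by simp
  qed
  ultimately show ?thesis by simp
qed

section \<open>The Rellich inequality on the Sobolev space\<close>

lemma L2_add:
  assumes "f \<in> L2" "g \<in> L2"
  shows "(\<lambda>x. f x + g x) \<in> L2"
proof -
  have [measurable]: "f \<in> borel_measurable lebesgue" "g \<in> borel_measurable lebesgue"
    using assms by (auto simp: L2_def)
  have "integrable lebesgue (\<lambda>x. (cmod (f x + g x))\<^sup>2)"
  proof (rule Bochner_Integration.integrable_bound)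
    show "integrable lebesgue (\<lambda>x. 2 * (cmod (f x))\<^sup>2 + 2 * (cmod (g x))\<^sup>2)"
      using assms by (auto simp: L2_def)
    have "(cmod (f x + g x))\<^sup>2 \<le> 2 * (cmod (f x))\<^sup>2 + 2 * (cmod (g x))\<^sup>2" for x
    proof -
      have "(cmod (f x + g x))\<^sup>2 \<le> (cmod (f x) + cmod (g x))\<^sup>2"
        by (intro power_mono norm_triangle_ineq norm_ge_zero)
      then show ?thesis
        using sum_squares_bound[of "cmod (f x)" "cmod (g x)"] by (simp add: power2_sum)
    qed
    then show "AE x in lebesgue. norm ((cmod (f x + g x))\<^sup>2) \<le> norm (2 * (cmod (f x))\<^sup>2 + 2 * (cmod (g x))\<^sup>2)"
      by (intro AE_I2) (simp add: abs_of_nonneg)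
  qed measurable
  then show ?thesis by (simp add: L2_def)
qed

lemma L2_sum:
  assumes "finite A" "\<And>a. a \<in> A \<Longrightarrow> f a \<in> L2"
  shows "(\<lambda>x. \<Sum>a\<in>A. f a x) \<in> L2"
  using assms by (induction A) (auto intro: L2_add, auto simp: L2_def)

lemma locally_integrable_diff:
  assumes "locally_integrable f" "locally_integrable g"
  shows "locally_integrable (\<lambda>x. f x - g x)"
  using assms unfolding locally_integrable_def by (blast intro: set_integral_diff(1))

lemma locally_integrable_sum:
  assumes "\<And>a. a \<in> A \<Longrightarrow> locally_integrable (f a)"
  shows "locally_integrable (\<lambda>x. \<Sum>a\<in>A. f a x)"
  using assms unfolding locally_integrable_def set_integrable_def
  by (auto simp: scaleR_sum_right intro!: Bochner_Integration.integrable_sum)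

lemma has_weak_derivative_unique:
  assumes "has_weak_derivative bs f g" "has_weak_derivative bs f h"
  shows "AE x in lebesgue. g x = h x"
proof -
  have li: "locally_integrable g" "locally_integrable h"
    using assms by (auto simp: has_weak_derivative_def)
  have "AE x in lebesgue. g x - h x = 0"
  proof (rule du_Bois_Reymond)
    show "locally_integrable (\<lambda>x. g x - h x)"
      using li by (rule locally_integrable_diff)
    fix \<phi> :: "'a \<Rightarrow> complex" assume \<phi>: "\<phi> \<in> test_functions"
    have "(-1) ^ length bs * (LINT x|lebesgue. g x * \<phi> x) = (-1) ^ length bs * (LINT x|lebesgue. h x * \<phi> x)"
      using assms \<phi> unfolding has_weak_derivative_def by (metis (no_types, lifting))
    then have "(LINT x|lebesgue. g x * \<phi> x) = (LINT x|lebesgue. h x * \<phi> x)"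
      by simp
    then show "(LINT x|lebesgue. (g x - h x) * \<phi> x) = 0"
      using integrable_mult_test[OF li(1) \<phi>] integrable_mult_test[OF li(2) \<phi>]
      by (simp add: left_diff_distrib)
  qed
  then show ?thesis by simp
qed

text \<open>The choice operator may return a weak derivative other than the square integrable
  \<open>g\<close>. Uniqueness makes the two agree almost everywhere, which transfers integrability
  of the square.\<close>

lemma weak_derivative_L2:
  assumes "g \<in> L2" "has_weak_derivative bs u g"
  shows "has_weak_derivative bs u (weak_derivative bs u)" "weak_derivative bs u \<in> L2"
proof -
  show w: "has_weak_derivative bs u (weak_derivative bs u)"
    unfolding weak_derivative_def by (rule someI[where P="has_weak_derivative bs u", OF assms(2)])
  then have m: "weak_derivative bs u \<in> borel_measurable lebesgue"
    by (intro locally_integrable_measurable) (simp add: has_weak_derivative_def)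
  have "AE x in lebesgue. g x = weak_derivative bs u x"
    using assms(2) w by (rule has_weak_derivative_unique)
  then have AE: "AE x in lebesgue. (cmod (g x))\<^sup>2 = (cmod (weak_derivative bs u x))\<^sup>2"
    by eventually_elim simp
  have "integrable lebesgue (\<lambda>x. (cmod (g x))\<^sup>2)"
    using assms(1) by (simp add: L2_def)
  moreover have "(\<lambda>x. (cmod (weak_derivative bs u x))\<^sup>2) \<in> borel_measurable lebesgue"
    using m by measurable
  ultimately have "integrable lebesgue (\<lambda>x. (cmod (weak_derivative bs u x))\<^sup>2)"
    using AE by (rule integrable_cong_AE_imp)
  then show "weak_derivative bs u \<in> L2"
    using m by (simp add: L2_def)
qed

lemma sobolev_H_weak_derivative:
  assumes "u \<in> sobolev_H k" "set bs \<subseteq> Basis" "length bs \<le> k"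
  shows "has_weak_derivative bs u (weak_derivative bs u)" "weak_derivative bs u \<in> L2"
proof -
  obtain g where "g \<in> L2" "has_weak_derivative bs u g"
    using assms unfolding sobolev_H_def by auto
  then show "has_weak_derivative bs u (weak_derivative bs u)" "weak_derivative bs u \<in> L2"
    by (rule weak_derivative_L2)+
qed

text \<open>The empty list is an admissible multi-index, and having a weak derivative of order 0
  already includes local integrability of \<open>u\<close>.\<close>

lemma sobolev_H_locally_integrable:
  assumes "u \<in> sobolev_H k"
  shows "locally_integrable u"
  using sobolev_H_weak_derivative(1)[OF assms, of "[]"] by (simp add: has_weak_derivative_def)

lemma weak_laplacian_L2:
  assumes "u \<in> sobolev_H 2"
  shows "weak_laplacian u \<in> L2" "locally_integrable (weak_laplacian u)"
proof -
  have "has_weak_derivative [b, b] u (weak_derivative [b, b] u)" "weak_derivative [b, b] u \<in> L2"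
    if "b \<in> Basis" for b
    using that by (intro sobolev_H_weak_derivative[OF assms]; simp)+
  then show "weak_laplacian u \<in> L2" "locally_integrable (weak_laplacian u)"
    unfolding weak_laplacian_def has_weak_derivative_def
    by (intro L2_sum locally_integrable_sum; simp)+
qed

section \<open>From mollifications to the Rellich inequality for \<open>H^2\<close>
  functions\<close>

lemma rellich_constant_pos:
  assumes "d \<ge> 5"
  shows "rellich_constant d > 0"
  using assms by (simp add: rellich_constant_def)

definition rellich_weight :: "real \<Rightarrow> 'a::euclidean_space \<Rightarrow> real" where
  "rellich_weight \<epsilon> x = 1 / (x \<bullet> x + \<epsilon>)\<^sup>2"

lemma rellich_weight:
  fixes x :: "'a::euclidean_space"
  assumes "\<epsilon> > 0"
  shows "continuous_on UNIV (rellich_weight \<epsilon> :: 'a \<Rightarrow> real)" "0 \<le> rellich_weight \<epsilon> x" "rellich_weight \<epsilon> x \<le> 1 / \<epsilon>\<^sup>2"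
proof -
  have pos: "x \<bullet> x + \<epsilon> > 0" for x :: 'a
    using assms inner_ge_zero[of x] by linarith
  then have "(x \<bullet> x + \<epsilon>)\<^sup>2 \<noteq> 0" for x :: 'a
    by (metis less_irrefl power_eq_0_iff)
  then show "continuous_on UNIV (rellich_weight \<epsilon> :: 'a \<Rightarrow> real)"
    unfolding rellich_weight_def by (intro continuous_intros) blast
  show "0 \<le> rellich_weight \<epsilon> x"
    by (simp add: rellich_weight_def)
  have "\<epsilon>\<^sup>2 \<le> (x \<bullet> x + \<epsilon>)\<^sup>2"
    using assms by (intro power_mono) auto
  then show "rellich_weight \<epsilon> x \<le> 1 / \<epsilon>\<^sup>2"
    unfolding rellich_weight_def using assms pos[of x]
    by (intro divide_left_mono mult_pos_pos zero_less_power) auto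
qed

lemma rellich_mollified:
  fixes u :: "'a::euclidean_space \<Rightarrow> complex"
  assumes dim: "DIM('a) \<ge> 5" and u: "u \<in> sobolev_H 2" and r: "mollifier s r" and \<epsilon>: "\<epsilon> > 0"
  shows "rellich_constant DIM('a) *
      (LINT x|lborel. (cmod (conv u (\<lambda>x. of_real (r x)) x))\<^sup>2 * rellich_weight \<epsilon> x)
    \<le> (LINT x|lebesgue. (cmod (weak_laplacian u x))\<^sup>2)"
proof -
  let ?\<rho> = "\<lambda>x. complex_of_real (r x)"
  have \<rho>: "?\<rho> \<in> test_functions" using r by (simp add: mollifier_def)
  define g where "g b = weak_derivative [b] u" for b
  define G where "G b = weak_derivative [b, b] u" for b
  have uL: "u \<in> L2" "locally_integrable u"
    using u sobolev_H_locally_integrable by (auto simp: sobolev_H_def)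
  have g: "has_weak_derivative [b] u (g b)" "g b \<in> L2" if "b \<in> Basis" for b
    using sobolev_H_weak_derivative[OF u, of "[b]"] that by (auto simp: g_def)
  have G: "has_weak_derivative [b, b] u (G b)" "G b \<in> L2" if "b \<in> Basis" for b
    using sobolev_H_weak_derivative[OF u, of "[b, b]"] that by (auto simp: G_def)
  have li: "locally_integrable (g b)" "locally_integrable (G b)" if "b \<in> Basis" for b
    using g(1)[OF that] G(1)[OF that] by (auto simp: has_weak_derivative_def)
  have sum: "(\<Sum>b\<in>Basis. conv (G b) ?\<rho> x) = conv (weak_laplacian u) ?\<rho> x" for x
    unfolding conv_def weak_laplacian_def G_def[symmetric] sum_distrib_right
    using conv_integrable[OF li(2) \<rho>] by (subst Bochner_Integration.integral_sum) auto
  have "rellich_constant DIM('a) * (LINT x|lborel. (cmod (conv u ?\<rho> x))\<^sup>2 / (x \<bullet> x + \<epsilon>)\<^sup>2)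
    \<le> (LINT x|lborel. (cmod (\<Sum>b\<in>Basis. conv (G b) ?\<rho> x))\<^sup>2)"
  proof (rule rellich_regularised[OF dim \<epsilon>, where ?u1.0="\<lambda>b. conv (g b) ?\<rho>"])
    fix b x :: 'a assume b: "b \<in> Basis"
    have "conv (g b) ?\<rho> x = conv u (iter_partial [b] ?\<rho>) x"
      using conv_weak_derivative[OF g(1)[OF b] \<rho>] b by simp
    then show "((\<lambda>t. conv u ?\<rho> (x + t *\<^sub>R b)) has_vector_derivative conv (g b) ?\<rho> x) (at 0)"
      using conv_directional_derivative[OF uL(2) \<rho> b] by simp
    have \<rho>': "iter_partial [b] ?\<rho> \<in> test_functions"
      using \<rho> b by (rule test_functions_partial)
    \<comment> \<open>The chosen first derivative \<open>g b\<close> and the chosen second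
      derivative \<open>G b\<close> are linked only through \<open>u\<close>. Hence both derivatives
      are first moved onto the mollifier, using its partial derivative as test function for
      \<open>g b\<close>, and then moved back together onto \<open>G b\<close>.\<close>
    have "conv (g b) (iter_partial [b] ?\<rho>) x = conv u (iter_partial [b] (iter_partial [b] ?\<rho>)) x"
      using conv_weak_derivative[OF g(1)[OF b] \<rho>'] b by simp
    also have "\<dots> = conv (G b) ?\<rho> x"
      using conv_weak_derivative[OF G(1)[OF b] \<rho>] b by simp
    finally show "((\<lambda>t. conv (g b) ?\<rho> (x + t *\<^sub>R b)) has_vector_derivative conv (G b) ?\<rho> x) (at 0)"
      using conv_directional_derivative[OF li(1)[OF b] \<rho> b, of x] by simp
  qed (use uL g G li r \<rho> conv_mollifier_L2(1) conv_continuous in blast)+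
  also have "\<dots> \<le> (LINT x|lebesgue. (cmod (weak_laplacian u x))\<^sup>2)"
    unfolding sum using weak_laplacian_L2[OF u] by (intro conv_mollifier_L2(2)[OF r])
  finally show ?thesis by (simp add: rellich_weight_def)
qed

text \<open>
  Since \<open>2 u \<bullet> \<psi> - |\<psi>|\<^sup>2 \<le> |u|\<^sup>2\<close> with equality for \<open>\<psi> = u\<close>, the weighted norm of \<open>u\<close> is the supremum
  over \<open>\<psi>\<close> of this pairing, which is affine in \<open>u\<close> and hence stable under weak limits.
\<close>

definition rellich_pairing where
  "rellich_pairing \<epsilon> u \<psi> = (LINT x|lebesgue. (2 * (u x \<bullet> \<psi> x) - (cmod (\<psi> x))\<^sup>2) * rellich_weight \<epsilon> x)"

lemma rellich_pairing_continuous: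
  fixes u \<psi> :: "'a::euclidean_space \<Rightarrow> complex"
  assumes dim: "DIM('a) \<ge> 5" and u: "u \<in> sobolev_H 2" and \<epsilon>: "\<epsilon> > 0"
    and \<psi>: "continuous_on UNIV \<psi>" and R: "\<And>x. norm x > R \<Longrightarrow> \<psi> x = 0"
  shows "rellich_constant DIM('a) * rellich_pairing \<epsilon> u \<psi> \<le> (LINT x|lebesgue. (cmod (weak_laplacian u x))\<^sup>2)"
proof -
  let ?C = "rellich_constant DIM('a)" and ?A = "LINT x|lebesgue. (cmod (weak_laplacian u x))\<^sup>2"
  define W where "W = (rellich_weight \<epsilon> :: 'a \<Rightarrow> real)"
  have W: "continuous_on UNIV W" "0 \<le> W x" "W x \<le> 1 / \<epsilon>\<^sup>2" for x
    unfolding W_def by (intro rellich_weight \<epsilon>)+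
  have C: "?C > 0" using dim by (rule rellich_constant_pos)
  have uL: "u \<in> L2" "locally_integrable u"
    using u sobolev_H_locally_integrable by (auto simp: sobolev_H_def)
  have "\<exists>r :: 'a \<Rightarrow> real. mollifier (1 / Suc n) r" for n
    using mollifier_exists[of "1 / Suc n"] by (metis of_nat_0_less_iff zero_less_Suc zero_less_divide_1_iff)
  then obtain r :: "nat \<Rightarrow> 'a \<Rightarrow> real" where r: "\<And>n. mollifier (1 / Suc n) (r n)"
    by metis
  define v where "v n = conv u (\<lambda>x. of_real (r n x))" for n
  \<comment> \<open>With this multiplier the real part of \<open>z * \<eta> x\<close> is the
    weighted real inner product of \<open>z\<close> with \<open>\<psi> x\<close>, which turns the
    pairing into the complex bilinear integral of \<open>conv_weak_limit\<close>.\<close>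
  define \<eta> where "\<eta> x = cnj (\<psi> x) * of_real (W x)" for x
  have \<eta>: "continuous_on UNIV \<eta>"
    unfolding \<eta>_def by (intro continuous_intros \<psi> W)
  have \<eta>0: "\<eta> x = 0" if "norm x > R" for x
    using R[OF that] by (simp add: \<eta>_def)
  have v: "continuous_on UNIV (v n)" "integrable lborel (\<lambda>x. (cmod (v n x))\<^sup>2)" for n
    using r[of n] uL unfolding v_def
    by (auto simp: mollifier_def intro!: conv_continuous conv_mollifier_L2(1)[OF r])
  define B where "B = (LINT x|lebesgue. (cmod (\<psi> x))\<^sup>2 * W x)"
  have B_int: "integrable lborel (\<lambda>x. (cmod (\<psi> x))\<^sup>2 * W x)"
    by (rule integrable_continuous_bounded_support[where R=R])
      (auto intro!: continuous_intros \<psi> W simp: R)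
  have B_eq: "B = (LINT x|lborel. (cmod (\<psi> x))\<^sup>2 * W x)"
    unfolding B_def using B_int by (intro integral_completion) simp
  have B_int': "integrable lebesgue (\<lambda>x. (cmod (\<psi> x))\<^sup>2 * W x)"
    using B_int by (subst integrable_completion) auto
  have Re: "Re (z * \<eta> x) = (z \<bullet> \<psi> x) * W x" for z x
    by (simp add: \<eta>_def inner_complex_def algebra_simps)
  have "(\<lambda>n. LINT x|lborel. v n x * \<eta> x) \<longlonglongrightarrow> (LINT x|lebesgue. u x * \<eta> x)"
    unfolding v_def using conv_weak_limit[OF uL(2) \<eta> \<eta>0 r] .
  then have lim: "(\<lambda>n. ?C * (2 * Re (LINT x|lborel. v n x * \<eta> x) - B)) \<longlonglongrightarrow> ?C * (2 * Re (LINT x|lebesgue. u x * \<eta> x) - B)"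
    by (intro tendsto_intros)
  have "?C * (2 * Re (LINT x|lborel. v n x * \<eta> x) - B) \<le> ?A" for n
  proof -
    have i1: "integrable lborel (\<lambda>x. v n x * \<eta> x)"
      by (rule integrable_continuous_bounded_support[where R=R])
        (auto intro!: continuous_intros \<eta> v simp: \<eta>0)
    have i2: "integrable lborel (\<lambda>x. W x * (v n x \<bullet> v n x))"
      by (intro integrable_weighted_inner[where K="1 / \<epsilon>\<^sup>2"] W v) (use W in auto)
    have i3: "integrable lborel (\<lambda>x. (v n x \<bullet> \<psi> x) * W x)"
      using integrable_Re[OF i1] by (simp only: Re)
    have "2 * Re (LINT x|lborel. v n x * \<eta> x) - B = (LINT x|lborel. 2 * ((v n x \<bullet> \<psi> x) * W x) - (cmod (\<psi> x))\<^sup>2 * W x)"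
      using i3 B_int unfolding B_eq integral_Re[OF i1, symmetric] Re by simp
    also have "\<dots> \<le> (LINT x|lborel. W x * (v n x \<bullet> v n x))"
    proof (intro integral_mono Bochner_Integration.integrable_diff integrable_mult_right i2 i3 B_int)
      fix x
      have "0 \<le> (v n x - \<psi> x) \<bullet> (v n x - \<psi> x)" by simp
      also have "\<dots> = v n x \<bullet> v n x - (2 * (v n x \<bullet> \<psi> x) - (cmod (\<psi> x))\<^sup>2)"
        by (simp add: power2_norm_eq_inner inner_diff_left inner_diff_right inner_commute)
      finally have "(2 * (v n x \<bullet> \<psi> x) - (cmod (\<psi> x))\<^sup>2) * W x \<le> (v n x \<bullet> v n x) * W x"
        using W(2) by (intro mult_right_mono) auto
      then show "2 * ((v n x \<bullet> \<psi> x) * W x) - (cmod (\<psi> x))\<^sup>2 * W x \<le> W x * (v n x \<bullet> v n x)"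
        by (simp add: algebra_simps)
    qed
    also have "\<dots> = (LINT x|lborel. (cmod (v n x))\<^sup>2 * W x)"
      unfolding power2_norm_eq_inner by (simp add: mult.commute)
    finally have "?C * (2 * Re (LINT x|lborel. v n x * \<eta> x) - B) \<le> ?C * (LINT x|lborel. (cmod (v n x))\<^sup>2 * W x)"
      using C by (intro mult_left_mono) auto
    also have "\<dots> \<le> ?A"
      unfolding v_def W_def by (rule rellich_mollified[OF dim u r \<epsilon>])
    finally show ?thesis .
  qed
  then have "?C * (2 * Re (LINT x|lebesgue. u x * \<eta> x) - B) \<le> ?A"
    by (intro LIMSEQ_le_const2[OF lim]) auto
  moreover have "2 * Re (LINT x|lebesgue. u x * \<eta> x) - B = rellich_pairing \<epsilon> u \<psi>"
  proof -
    have "bounded (\<eta> ` cball 0 R)"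
      by (intro compact_imp_bounded compact_continuous_image continuous_on_subset[OF \<eta>]) auto
    then obtain M where M: "M > 0" "\<And>x. x \<in> cball 0 R \<Longrightarrow> norm (\<eta> x) \<le> M"
      by (auto simp: bounded_pos)
    have M': "norm (\<eta> x) \<le> M" for x
      using M \<eta>0[of x] by (cases "norm x > R") auto
    have i: "integrable lebesgue (\<lambda>x. u x * \<eta> x)"
      by (rule locally_integrable_integrable_mult[OF uL(2) measurable_lebesgue_continuous[OF \<eta>] M' \<eta>0])
    have i': "integrable lebesgue (\<lambda>x. (u x \<bullet> \<psi> x) * W x)"
      using integrable_Re[OF i] by (simp only: Re)
    have "rellich_pairing \<epsilon> u \<psi> = (LINT x|lebesgue. 2 * ((u x \<bullet> \<psi> x) * W x) - (cmod (\<psi> x))\<^sup>2 * W x)"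
      unfolding rellich_pairing_def W_def[symmetric] by (simp add: left_diff_distrib mult.assoc)
    also have "\<dots> = 2 * Re (LINT x|lebesgue. u x * \<eta> x) - B"
      using i' B_int' unfolding B_def integral_Re[OF i, symmetric] Re by simp
    finally show ?thesis by simp
  qed
  ultimately show ?thesis by simp
qed

text \<open>The pairing is to be evaluated at truncations of \<open>u\<close> itself, which are
  bounded and boundedly supported but only measurable. They are a.e. limits of continuous functions
  with a common bound, and the pairing is continuous along such limits.\<close>

lemma rellich_pairing_bounded:
  fixes u \<psi> :: "'a::euclidean_space \<Rightarrow> complex"
  assumes dim: "DIM('a) \<ge> 5" and u: "u \<in> sobolev_H 2" and \<epsilon>: "\<epsilon> > 0"
    and \<psi>: "\<psi> \<in> borel_measurable lebesgue" and N: "\<And>x. cmod (\<psi> x) \<le> N"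
    and R: "\<And>x. norm x > R \<Longrightarrow> \<psi> x = 0"
  shows "rellich_constant DIM('a) * rellich_pairing \<epsilon> u \<psi> \<le> (LINT x|lebesgue. (cmod (weak_laplacian u x))\<^sup>2)"
proof -
  define W where "W = (rellich_weight \<epsilon> :: 'a \<Rightarrow> real)"
  have W: "continuous_on UNIV W" "0 \<le> W x" "W x \<le> 1 / \<epsilon>\<^sup>2" for x
    unfolding W_def by (intro rellich_weight \<epsilon>)+
  have uli: "locally_integrable u"
    using u by (rule sobolev_H_locally_integrable)
  obtain G where G: "\<And>n::nat. continuous_on UNIV (G n)" "\<And>n x. norm (G n x) \<le> N"
    "AE x in lebesgue. (\<lambda>n. G n x) \<longlonglongrightarrow> \<psi> x"
    using bounded_measurable_approx[OF \<psi> N] by blast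
  \<comment> \<open>A continuous cutoff that is 1 on the support of \<open>\<psi>\<close>: the
    approximants acquire a common bounded support while their limit remains
    \<open>\<psi>\<close>.\<close>
  define \<xi> where "\<xi> x = max 0 (min 1 (R + 1 - norm x))" for x :: 'a
  have \<xi>: "continuous_on UNIV \<xi>" "0 \<le> \<xi> x" "\<xi> x \<le> 1" "norm x > R + 1 \<Longrightarrow> \<xi> x = 0"
    "norm x \<le> R \<Longrightarrow> \<xi> x = 1" for x
    unfolding \<xi>_def by (auto intro!: continuous_intros)
  have N0: "N \<ge> 0" using N[of 0] norm_ge_zero order_trans by blast
  define g where "g n x = \<xi> x *\<^sub>R G n x" for n x
  have g: "continuous_on UNIV (g n)" for n
    unfolding g_def by (intro continuous_intros \<xi> G)
  have g0: "g n x = 0" if "norm x > R + 1" for n x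
    using \<xi>(4)[OF that] by (simp add: g_def)
  have gN: "cmod (g n x) \<le> N" for n x
    using G(2)[of n x] \<xi>(2,3)[of x] mult_mono[of "\<xi> x" 1 "cmod (G n x)" N] by (simp add: g_def)
  have g_lim: "AE x in lebesgue. (\<lambda>n. g n x) \<longlonglongrightarrow> \<psi> x"
    using G(3)
  proof eventually_elim
    case (elim x)
    then have "(\<lambda>n. g n x) \<longlonglongrightarrow> \<xi> x *\<^sub>R \<psi> x"
      unfolding g_def by (intro tendsto_intros)
    moreover have "\<xi> x *\<^sub>R \<psi> x = \<psi> x"
      using \<xi>(5)[of x] R[of x] by (cases "norm x \<le> R") auto
    ultimately show ?case by simp
  qed
  note [measurable] = \<psi> locally_integrable_measurable[OF uli] measurable_lebesgue_continuous[OF g]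
    measurable_lebesgue_continuous[OF W(1)]
  let ?I = "\<lambda>x::'a. indicat_real (cball 0 (R + 1)) x"
  have "(\<lambda>n. rellich_pairing \<epsilon> u (g n)) \<longlonglongrightarrow> rellich_pairing \<epsilon> u \<psi>"
    unfolding rellich_pairing_def W_def[symmetric]
  proof (rule integral_dominated_convergence)
    have "integrable lebesgue (\<lambda>x. ?I x *\<^sub>R (1::real))"
      using lmeasurable_cball[of "0::'a" "R + 1"] fmeasurableD2[OF lmeasurable_cball, of "0::'a" "R + 1"]
      by (auto simp: less_top fmeasurableD intro!: integrable_real_indicator)
    then show "integrable lebesgue (\<lambda>x. (2 * N * cmod (?I x *\<^sub>R u x) + N\<^sup>2 * ?I x) * (1 / \<epsilon>\<^sup>2))"
      by (intro integrable_mult_left Bochner_Integration.integrable_add integrable_mult_right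
          integrable_norm locally_integrable_cball uli) simp
    show "AE x in lebesgue. (\<lambda>n. (2 * (u x \<bullet> g n x) - (cmod (g n x))\<^sup>2) * W x)
        \<longlonglongrightarrow> (2 * (u x \<bullet> \<psi> x) - (cmod (\<psi> x))\<^sup>2) * W x"
      using g_lim by eventually_elim (intro tendsto_intros)
    have "norm ((2 * (u x \<bullet> g n x) - (cmod (g n x))\<^sup>2) * W x) \<le> (2 * N * cmod (?I x *\<^sub>R u x) + N\<^sup>2 * ?I x) * (1 / \<epsilon>\<^sup>2)" for n x
    proof (cases "norm x > R + 1")
      case False
      have "\<bar>u x \<bullet> g n x\<bar> \<le> cmod (u x) * N"
        using Cauchy_Schwarz_ineq2[of "u x" "g n x"] mult_left_mono[OF gN[of n x] norm_ge_zero[of "u x"]]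
        by linarith
      moreover have "(cmod (g n x))\<^sup>2 \<le> N\<^sup>2"
        by (intro power_mono gN norm_ge_zero)
      moreover have "0 \<le> (cmod (g n x))\<^sup>2" by simp
      ultimately have "\<bar>2 * (u x \<bullet> g n x) - (cmod (g n x))\<^sup>2\<bar> \<le> 2 * (cmod (u x) * N) + N\<^sup>2"
        by linarith
      then have "\<bar>2 * (u x \<bullet> g n x) - (cmod (g n x))\<^sup>2\<bar> * W x \<le> (2 * (cmod (u x) * N) + N\<^sup>2) * (1 / \<epsilon>\<^sup>2)"
        using W(2,3)[of x] N0 by (intro mult_mono) auto
      then show ?thesis
        using False W(2)[of x] by (simp add: abs_mult mult.commute mult.left_commute)
    qed (simp add: g0)
    then show "AE x in lebesgue. norm ((2 * (u x \<bullet> g n x) - (cmod (g n x))\<^sup>2) * W x)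
        \<le> (2 * N * cmod (?I x *\<^sub>R u x) + N\<^sup>2 * ?I x) * (1 / \<epsilon>\<^sup>2)" for n
      by (intro AE_I2)
  qed measurable
  then have "(\<lambda>n. rellich_constant DIM('a) * rellich_pairing \<epsilon> u (g n)) \<longlonglongrightarrow> rellich_constant DIM('a) * rellich_pairing \<epsilon> u \<psi>"
    by (intro tendsto_intros)
  then show ?thesis
    by (rule LIMSEQ_le_const2) (use rellich_pairing_continuous[OF dim u \<epsilon> g g0] in blast)
qed

theorem rellich_inequality:
  fixes u :: "'a::euclidean_space \<Rightarrow> complex"
  assumes dim: "DIM('a) \<ge> 5" and u: "u \<in> sobolev_H 2"
  shows "(\<integral>\<^sup>+x. ennreal ((cmod (u x))\<^sup>2 / norm x ^ 4) \<partial>lebesgue)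
    \<le> ennreal ((LINT x|lebesgue. (cmod (weak_laplacian u x))\<^sup>2) / rellich_constant DIM('a))"
proof -
  let ?C = "rellich_constant DIM('a)" and ?A = "LINT x|lebesgue. (cmod (weak_laplacian u x))\<^sup>2"
  have C: "?C > 0" using dim by (rule rellich_constant_pos)
  have u2: "integrable lebesgue (\<lambda>x. (cmod (u x))\<^sup>2)" and [measurable]: "u \<in> borel_measurable lebesgue"
    using u by (auto simp: sobolev_H_def L2_def)
  have [measurable]: "(\<lambda>x::'a. norm x) \<in> borel_measurable lebesgue"
    by (intro measurable_lebesgue_continuous continuous_intros)
  \<comment> \<open>Each value of \<open>f n\<close> is either \<open>u x\<close> or 0, so
    \<open>2 (u \<bullet> f n) - |f n|^2\<close> collapses to \<open>|f n|^2\<close> and the pairing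
    becomes a weighted norm. Truncation and \<open>\<epsilon> = 1 / Suc n\<close> are tied to the
    same index, so one application of Fatou removes both.\<close>
  define f where "f n x = (if cmod (u x) \<le> real n \<and> norm x \<le> real n then u x else 0)" for n x
  define W where "W n = (rellich_weight (1 / Suc n) :: 'a \<Rightarrow> real)" for n
  have e: "1 / real (Suc n) > 0" for n by simp
  have W: "continuous_on UNIV (W n)" "0 \<le> W n x" "W n x \<le> 1 / (1 / Suc n)\<^sup>2" for n x
    unfolding W_def by (intro rellich_weight e)+
  note [measurable] = measurable_lebesgue_continuous[OF W(1)]
  have f_meas[measurable]: "f n \<in> borel_measurable lebesgue" for n
    unfolding f_def by measurable
  have le: "(\<integral>\<^sup>+x. ennreal ((cmod (f n x))\<^sup>2 * W n x) \<partial>lebesgue) \<le> ennreal (?A / ?C)" for n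
  proof -
    have "?C * rellich_pairing (1 / Suc n) u (f n) \<le> ?A"
      by (rule rellich_pairing_bounded[OF dim u e f_meas, where N="real n" and R="real n"])
        (auto simp: f_def)
    moreover have "(2 * (u x \<bullet> f n x) - (cmod (f n x))\<^sup>2) = (cmod (f n x))\<^sup>2" for x
      by (auto simp: f_def simp flip: power2_norm_eq_inner)
    ultimately have *: "(LINT x|lebesgue. (cmod (f n x))\<^sup>2 * W n x) \<le> ?A / ?C"
      using C by (simp add: rellich_pairing_def W_def field_simps)
    have "integrable lebesgue (\<lambda>x. (cmod (f n x))\<^sup>2 * W n x)"
    proof (rule Bochner_Integration.integrable_bound)
      show "integrable lebesgue (\<lambda>x. (cmod (u x))\<^sup>2 * (1 / (1 / Suc n)\<^sup>2))"
        using u2 by (intro integrable_mult_left)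
      have "(cmod (f n x))\<^sup>2 * W n x \<le> (cmod (u x))\<^sup>2 * (1 / (1 / Suc n)\<^sup>2)" for x
        using W(2,3)[of n x] by (intro mult_mono) (auto simp: f_def)
      then show "AE x in lebesgue. norm ((cmod (f n x))\<^sup>2 * W n x) \<le> norm ((cmod (u x))\<^sup>2 * (1 / (1 / Suc n)\<^sup>2))"
        using W(2) by (intro AE_I2) (simp add: abs_mult)
    qed measurable
    then have "(\<integral>\<^sup>+x. ennreal ((cmod (f n x))\<^sup>2 * W n x) \<partial>lebesgue) = ennreal (LINT x|lebesgue. (cmod (f n x))\<^sup>2 * W n x)"
      using W(2) by (intro nn_integral_eq_integral) auto
    then show ?thesis
      using * by (simp add: ennreal_leI)
  qed
  have "(\<integral>\<^sup>+x. ennreal ((cmod (u x))\<^sup>2 / norm x ^ 4) \<partial>lebesgue)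
      \<le> (\<integral>\<^sup>+x. liminf (\<lambda>n. ennreal ((cmod (f n x))\<^sup>2 * W n x)) \<partial>lebesgue)"
  proof (rule nn_integral_mono)
    fix x :: 'a
    show "ennreal ((cmod (u x))\<^sup>2 / norm x ^ 4) \<le> liminf (\<lambda>n. ennreal ((cmod (f n x))\<^sup>2 * W n x))"
    \<comment> \<open>At the origin the left-hand side is 0 because division by 0 gives 0.\<close>
    proof (cases "x = 0")
      case False
      have "(\<lambda>n. (cmod (u x))\<^sup>2 * (1 / (x \<bullet> x + 1 / Suc n)\<^sup>2)) \<longlonglongrightarrow> (cmod (u x))\<^sup>2 * (1 / (x \<bullet> x + 0)\<^sup>2)"
        using False by (intro tendsto_intros LIMSEQ_Suc[OF lim_1_over_n]) auto
      moreover have "\<forall>\<^sub>F n in sequentially. (cmod (u x))\<^sup>2 * (1 / (x \<bullet> x + 1 / Suc n)\<^sup>2) = (cmod (f n x))\<^sup>2 * W n x"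
      proof -
        have "\<forall>\<^sub>F n in sequentially. n \<ge> nat \<lceil>max (cmod (u x)) (norm x)\<rceil>"
          by (rule eventually_ge_at_top)
        then show ?thesis
        proof eventually_elim
          case (elim n)
          then have "max (cmod (u x)) (norm x) \<le> real n" by linarith
          then show ?case by (simp add: f_def W_def rellich_weight_def)
        qed
      qed
      ultimately have "(\<lambda>n. (cmod (f n x))\<^sup>2 * W n x) \<longlonglongrightarrow> (cmod (u x))\<^sup>2 * (1 / (x \<bullet> x + 0)\<^sup>2)"
        by (rule Lim_transform_eventually)
      also have "(cmod (u x))\<^sup>2 * (1 / (x \<bullet> x + 0)\<^sup>2) = (cmod (u x))\<^sup>2 / norm x ^ 4"
        by (simp add: power2_norm_eq_inner[of x, symmetric])
      finally have "(\<lambda>n. ennreal ((cmod (f n x))\<^sup>2 * W n x)) \<longlonglongrightarrow> ennreal ((cmod (u x))\<^sup>2 / norm x ^ 4)"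
        by (intro tendsto_ennrealI)
      then show ?thesis
        by (simp add: lim_imp_Liminf)
    qed simp
  qed
  also have "\<dots> \<le> liminf (\<lambda>n. \<integral>\<^sup>+x. ennreal ((cmod (f n x))\<^sup>2 * W n x) \<partial>lebesgue)"
    by (rule nn_integral_liminf) measurable
  also have "\<dots> \<le> liminf (\<lambda>n::nat. ennreal (?A / ?C))"
    using le by (intro Liminf_mono) auto
  also have "\<dots> = ennreal (?A / ?C)"
    by (simp add: Liminf_const)
  finally show ?thesis .
qed

section \<open>Location of eigenvalues\<close>

text \<open>The Cauchy-Schwarz estimate for the product of \<open>r^2 V u\<close> and
  \<open>u / r^2\<close>, obtained from a weighted arithmetic-geometric mean inequality so that the
  two bounds can be used directly as extended nonnegative integrals.\<close>

lemma norm_potential_integral_le: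
  fixes V u :: "'a::euclidean_space \<Rightarrow> complex"
  assumes u: "u \<in> borel_measurable lebesgue"
    and V: "(\<lambda>x. complex_of_real ((norm x)\<^sup>2) * V x) \<in> borel_measurable lebesgue"
    and le1: "(\<integral>\<^sup>+x. ennreal (norm x ^ 4 * (cmod (V x))\<^sup>2 * (cmod (u x))\<^sup>2) \<partial>lebesgue) \<le> ennreal (a\<^sup>2 * A)"
    and le2: "(\<integral>\<^sup>+x. ennreal ((cmod (u x))\<^sup>2 / norm x ^ 4) \<partial>lebesgue) \<le> ennreal (A / k\<^sup>2)"
    and pos: "a > 0" "k > 0" "A \<ge> 0"
  shows "cmod (LINT x|lebesgue. V x * u x * cnj (u x)) \<le> a / k * A"
\<comment> \<open>Without integrability the Bochner integral is 0 by convention and the bound is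
  trivial.\<close>
proof (cases "integrable lebesgue (\<lambda>x. V x * u x * cnj (u x))")
  case True
  have [measurable]: "(\<lambda>x::'a. norm x) \<in> borel_measurable lebesgue"
    by (intro measurable_lebesgue_continuous continuous_intros)
  note [measurable] = u V
  let ?p = "\<lambda>x. norm x ^ 4 * (cmod (V x))\<^sup>2 * (cmod (u x))\<^sup>2" and ?q = "\<lambda>x. (cmod (u x))\<^sup>2 / norm x ^ 4"
  have p_meas: "?p \<in> borel_measurable lebesgue"
  proof -
    have "?p = (\<lambda>x. (cmod (complex_of_real ((norm x)\<^sup>2) * V x))\<^sup>2 * (cmod (u x))\<^sup>2)"
      by (simp add: fun_eq_iff norm_mult power_mult_distrib norm_power)
    then show ?thesis by (simp only:) measurable
  qed
  have q_meas: "?q \<in> borel_measurable lebesgue" by measurable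
  \<comment> \<open>Two conditions fix \<open>l\<close> and \<open>m\<close>:
    \<open>4 l m = 1\<close>, so that \<open>l p + m q\<close> dominates the product, and
    \<open>l a^2 = m / k^2\<close>, so that both terms contribute the same amount
    \<open>a A / (2 k)\<close>. These are the optimal weights.\<close>
  define l where "l = 1 / (2 * (a * k))"
  define m where "m = a * k / 2"
  have lm: "l > 0" "m > 0" using pos by (auto simp: l_def m_def)
  have ennreal_comb: "ennreal l * ennreal P + ennreal m * ennreal Q = ennreal (l * P + m * Q)"
    if "P \<ge> 0" "Q \<ge> 0" for P Q
    using that lm by (simp add: ennreal_mult ennreal_plus)
  have pointwise: "cmod (V x * u x * cnj (u x)) \<le> l * ?p x + m * ?q x" if "x \<noteq> 0" for x
  proof -
    define t where "t = sqrt (2 * l) * ((norm x)\<^sup>2 * cmod (V x) * cmod (u x))"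
    define s where "s = sqrt (2 * m) * (cmod (u x) / (norm x)\<^sup>2)"
    have "sqrt (2 * l) * sqrt (2 * m) = 1"
      using pos by (simp add: l_def m_def flip: real_sqrt_mult)
    then have "t * s = cmod (V x) * cmod (u x) * cmod (u x)"
      using that by (simp add: t_def s_def field_simps)
    moreover have "t\<^sup>2 = 2 * l * ?p x" "s\<^sup>2 = 2 * m * ?q x"
      using lm by (simp_all add: t_def s_def power_mult_distrib power_divide)
    ultimately show ?thesis
      using sum_squares_bound[of t s] by (simp add: norm_mult)
  qed
  have "ennreal (cmod (LINT x|lebesgue. V x * u x * cnj (u x))) \<le> (\<integral>\<^sup>+x. ennreal (cmod (V x * u x * cnj (u x))) \<partial>lebesgue)"
    using True by (rule integral_norm_bound_ennreal)
  also have "\<dots> \<le> (\<integral>\<^sup>+x. ennreal l * ennreal (?p x) + ennreal m * ennreal (?q x) \<partial>lebesgue)"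
  proof (rule nn_integral_mono_AE)
    \<comment> \<open>The origin has to be left out: there both weighted terms evaluate to 0,
      whereas \<open>V x * u x * cnj (u x)\<close> is unrestricted.\<close>
    have "AE x in lebesgue. x \<noteq> (0::'a)"
      by (rule AE_completion[OF AE_lborel_singleton])
    then show "AE x in lebesgue. ennreal (cmod (V x * u x * cnj (u x))) \<le> ennreal l * ennreal (?p x) + ennreal m * ennreal (?q x)"
    proof eventually_elim
      case (elim x)
      have "ennreal l * ennreal (?p x) + ennreal m * ennreal (?q x) = ennreal (l * ?p x + m * ?q x)"
        by (rule ennreal_comb) auto
      then show ?case
        using pointwise[OF elim] by (simp only: ennreal_leI)
    qed
  qed
  also have "\<dots> = ennreal l * (\<integral>\<^sup>+x. ennreal (?p x) \<partial>lebesgue) + ennreal m * (\<integral>\<^sup>+x. ennreal (?q x) \<partial>lebesgue)"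
    using p_meas q_meas by (subst nn_integral_add) (auto simp: nn_integral_cmult)
  also have "\<dots> \<le> ennreal l * ennreal (a\<^sup>2 * A) + ennreal m * ennreal (A / k\<^sup>2)"
    using le1 le2 by (intro add_mono mult_left_mono) auto
  also have "\<dots> = ennreal (l * (a\<^sup>2 * A) + m * (A / k\<^sup>2))"
    using pos by (intro ennreal_comb) auto
  also have "l * (a\<^sup>2 * A) + m * (A / k\<^sup>2) = a / k * A"
    using pos by (simp add: l_def m_def power2_eq_square field_simps)
  finally show ?thesis
    using pos by (simp add: ennreal_le_iff)
qed (use pos in \<open>simp add: not_integrable_integral_eq\<close>)

lemma eigenvalue_sector:
  fixes z w :: complex
  assumes eq: "of_real A + w = z * of_real N" and w: "cmod w \<le> \<kappa> * A"
    and pos: "A \<ge> 0" "N > 0" "\<delta> > 0" and \<kappa>: "(1 + 1 / \<delta>) * \<kappa> < 1"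
  shows "\<bar>Im z\<bar> \<le> \<delta> * Re z"
proof -
  have re: "A + Re w = Re z * N" and im: "Im w = Im z * N"
    using arg_cong[OF eq, of Re] arg_cong[OF eq, of Im] by auto
  have "\<kappa> \<le> \<delta> * (1 - \<kappa>)"
    using \<kappa> pos by (simp add: field_simps)
  then have "\<kappa> * A \<le> \<delta> * (1 - \<kappa>) * A"
    using pos by (intro mult_right_mono)
  also have "\<dots> = \<delta> * (A - \<kappa> * A)" by (simp add: algebra_simps)
  also have "\<dots> \<le> \<delta> * (A + Re w)"
    using pos w abs_Re_le_cmod[of w] by (intro mult_left_mono) auto
  finally have "\<kappa> * A \<le> \<delta> * Re z * N"
    by (simp add: re mult.assoc)
  moreover have "\<bar>Im z\<bar> * N = \<bar>Im w\<bar>"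
    using pos by (simp add: im abs_mult)
  ultimately have "\<bar>Im z\<bar> * N \<le> \<delta> * Re z * N"
    using w abs_Im_le_cmod[of w] by linarith
  then show ?thesis using pos by simp
qed

theorem theorem1p2:
  fixes V :: "real ^ 'n \<Rightarrow> complex" and \<delta> a :: real
  assumes "CARD('n) \<ge> 5"
    and "locally_integrable V"
    and "(\<lambda>x. complex_of_real ((norm x)\<^sup>2) * V x) \<in> L2_loc"
    and "\<delta> > 0"
    and "a > 0"
    and "\<forall>\<psi>\<in>sobolev_H 2.
      (\<integral>\<^sup>+x. ennreal ((norm x) ^ 4 * (cmod (V x))\<^sup>2 * (cmod (\<psi> x))\<^sup>2) \<partial>lebesgue)
        \<le> ennreal (a\<^sup>2) * (\<integral>\<^sup>+x. ennreal ((cmod (weak_laplacian \<psi> x))\<^sup>2) \<partial>lebesgue)"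
    and "(1 + 1 / \<delta>) * (a / sqrt (rellich_constant CARD('n))) < 1"
  shows "point_spectrum_bilaplacian V \<subseteq> {z. \<bar>Im z\<bar> \<le> \<delta> * Re z}"
proof
  fix z assume "z \<in> point_spectrum_bilaplacian V"
  then obtain u where u: "u \<in> sobolev_H 2" and nz: "\<not> (AE x in lebesgue. u x = 0)"
    and eq: "(LINT x|lebesgue. weak_laplacian u x * cnj (weak_laplacian u x)) +
      (LINT x|lebesgue. V x * u x * cnj (u x)) = z * (LINT x|lebesgue. u x * cnj (u x))"
    unfolding point_spectrum_bilaplacian_def by blast
  define A where "A = (LINT x|lebesgue. (cmod (weak_laplacian u x))\<^sup>2)"
  define N where "N = (LINT x|lebesgue. (cmod (u x))\<^sup>2)"
  define k where "k = sqrt (rellich_constant CARD('n))"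
  have C: "rellich_constant CARD('n) > 0"
    using assms(1) by (rule rellich_constant_pos)
  have k: "k > 0" "k\<^sup>2 = rellich_constant CARD('n)"
    using C by (auto simp: k_def)
  have uL: "u \<in> borel_measurable lebesgue" "integrable lebesgue (\<lambda>x. (cmod (u x))\<^sup>2)"
    using u by (auto simp: sobolev_H_def L2_def)
  have A: "A \<ge> 0" unfolding A_def by (intro integral_nonneg_AE) auto
  have N0: "N \<ge> 0" unfolding N_def by (intro integral_nonneg_AE) auto
  have "N \<noteq> 0"
    using nz integral_nonneg_eq_0_iff_AE[OF uL(2)] by (simp add: N_def)
  \<comment> \<open>The assumption on \<open>V\<close> compares extended nonnegative integrals;
    square integrability of the weak Laplacian makes its right-hand side the finite number
    \<open>a^2 A\<close>.\<close>
  have "(\<integral>\<^sup>+x. ennreal ((cmod (weak_laplacian u x))\<^sup>2) \<partial>lebesgue) = ennreal A"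
    unfolding A_def using weak_laplacian_L2(1)[OF u]
    by (intro nn_integral_eq_integral) (auto simp: L2_def)
  then have le1: "(\<integral>\<^sup>+x. ennreal ((norm x) ^ 4 * (cmod (V x))\<^sup>2 * (cmod (u x))\<^sup>2) \<partial>lebesgue) \<le> ennreal (a\<^sup>2 * A)"
    using assms(6)[rule_format, OF u] A by (simp add: ennreal_mult)
  have le2: "(\<integral>\<^sup>+x. ennreal ((cmod (u x))\<^sup>2 / norm x ^ 4) \<partial>lebesgue) \<le> ennreal (A / k\<^sup>2)"
    using rellich_inequality[OF _ u] assms(1) by (simp add: A_def k)
  have w: "cmod (LINT x|lebesgue. V x * u x * cnj (u x)) \<le> a / k * A"
    using assms(3) by (intro norm_potential_integral_le uL le1 le2 assms(5) k A) (simp add: L2_loc_def)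
  have "of_real A + (LINT x|lebesgue. V x * u x * cnj (u x)) = z * of_real N"
    using eq by (simp add: A_def N_def flip: complex_norm_square of_real_power)
  then have "\<bar>Im z\<bar> \<le> \<delta> * Re z"
    using assms(7) \<open>N \<noteq> 0\<close> N0
    by (intro eigenvalue_sector[OF _ w A _ assms(4)]) (auto simp: k_def)
  then show "z \<in> {z. \<bar>Im z\<bar> \<le> \<delta> * Re z}" by simp
qed

end
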